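(* Let $X$ be a Tychonoff space, $(Y,\rho)$ be a complete metric space and $\Phi:X\to\mathscr{F}_{\mathbf c}(Y)$ be such that $\{\Phi(x):x\in X\}$ is uniformly equi-$LC^0$. If $\theta:X\to\mathscr{C}(Y)$ is a selection for $\Phi$ such that the mapping $\mathscr{C}_{\mathbf c}[\theta,\Phi]:X\to\mathscr{F}_{\mathbf c}(\mathscr{C}_{\mathbf c}(Y))$ is $H(\rho)$-s.l.s.f., then there exists a continuous mapping $\varphi:X\to\mathscr{C}_{\mathbf c}(Y)$ with $\theta\leqslant\varphi\leqslant\Phi$.
   Context: All spaces are infinite Hausdorff topological spaces. For a set $Y$, $2^Y$ denotes the family of all nonempty subsets of $Y$. For a space $Y$: $\mathscr{F}(Y)$ and $\mathscr{C}(Y)$ are the families of all nonempty closed, respectively nonempty compact, subsets of $Y$; $\mathscr{F}_{\mathbf c}(Y)$ and $\mathscr{C}_{\mathbf c}(Y)$ are the families of their connected members. $w(Y)$ is the topological weight of $Y$. A mapping $\Phi:X\to 2^Y$ is l.s.c. if $\{x\in X:\Phi(x)\cap U\neq\varnothing\}$ is open for every open $U\subseteq Y$; u.s.c. if $\{x\in X:\Phi(x)\cap F\neq\varnothing\}$ is closed for every closed $F\subseteq Y$; continuous if it is both. For $\theta,\Phi:X\to 2^Y$, $\theta\leqslant\Phi$ (i.e. $\theta$ is a selection for $\Phi$) means $\theta(x)\subseteq\Phi(x)$ for all $x\in X$. For a metric space $(Y,\rho)$ and $S\subseteq Y$, $\mathbf{O}^\rho_\varepsilon(S)$ is the union of the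 open $\varepsilon$-balls centred at points of $S$. $\mathscr{C}(Y)$ is equipped with the Hausdorff distance $H(\rho)(S,T)=\inf\{\varepsilon>0: S\subseteq\mathbf{O}^\rho_\varepsilon(T)\text{ and }T\subseteq\mathbf{O}^\rho_\varepsilon(S)\}$ and the topology it generates; $\mathscr{C}_{\mathbf c}(Y)$ is a subspace. A family $\mathscr{S}\subseteq 2^Y$ is uniformly equi-$LC^0$ if for every $\varepsilon>0$ there is $\delta(\varepsilon)>0$ such that for every $S\in\mathscr{S}$, every two points $y_0,y_1\in S$ with $\rho(y_0,y_1)<\delta(\varepsilon)$ can be joined by a path in $S$ of diameter $<\varepsilon$. For a metric space $(E,d)$, a mapping $\Psi:X\to 2^E$ is strongly lower semi-factorizable with respect to $d$, or $d$-s.l.s.f., if for every closed $F\subseteq X$, every $\varepsilon>0$ and every (not necessarily continuous) $\sigma:F\to\mathscr{C}(E)$ with $\sigma(x)\subseteq\Psi(x)$ for all $x\in F$, there exist a locally finite covering $\mathscr{U}$ of $F$ by cozero-sets in $F$ and a map $\pi:\mathscr{U}\to F$ such that $|\mathscr{U}|\leq w(E)$ and $\sigma(\pi(U))\subseteq\mathbf{O}^d_\varepsilon(\Psi(x))$ for every $x\in U\in\mathscr{U}$. For $\Phi:X\to\mathscr{F}(Y)$ and $\theta:X\to\mathscr{C}(Y)$ with $\theta\leqslant\Phi$, $\mathscr{C}_{\mathbf c}[\theta,\Phi](x)=\{S\in\mathscr{C}_{\mathbf c}(Y):\theta(x)\subseteq S\subseteq\Phi(x)\}$, $x\in X$. When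 the values of $\Phi$ are connected and locally path-connected, this is a mapping $X\to\mathscr{F}_{\mathbf c}(\mathscr{C}_{\mathbf c}(Y))$; it is regarded as a mapping into subsets of the metric space $(\mathscr{C}_{\mathbf c}(Y),H(\rho))$. *)

theory Defs
  imports "HOL-Analysis.Analysis"
begin

unbundle cardinal_syntax

definition is_base :: "'a topology \<Rightarrow> 'a set set \<Rightarrow> bool" where
  "is_base T B \<longleftrightarrow> (\<forall>U\<in>B. openin T U) \<and> (\<forall>U. openin T U \<longrightarrow> (\<exists>C\<subseteq>B. U = \<Union>C))"

(* The weight is represented by a cardinal (a well-order) on 'a set: the cardinality of a base of
   least cardinality. *)
definition weight :: "'a topology \<Rightarrow> 'a set rel" where
  "weight T = |SOME B. is_base T B \<and> (\<forall>B'. is_base T B' \<longrightarrow> |B| \<le>o |B'| )|"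

lemma is_base_openin: "is_base T {U. openin T U}"
  unfolding is_base_def by (auto intro!: exI[of _ "{_}"])

lemma weight_attained:
  obtains B where "is_base T B" "weight T = |B|" "\<And>B'. is_base T B' \<Longrightarrow> weight T \<le>o |B'|"
proof -
  let ?R = "card_of ` {B. is_base T B}"
  have ne: "?R \<noteq> {}" using is_base_openin[of T] by auto
  have "\<forall>r\<in>?R. Card_order r" by (auto intro: card_of_Card_order)
  from exists_minim_Card_order[OF ne this]
  obtain r where r: "r \<in> ?R" "\<forall>r'\<in>?R. r \<le>o r'" by blast
  then have ex: "\<exists>B. is_base T B \<and> (\<forall>B'. is_base T B' \<longrightarrow> |B| \<le>o |B'| )" by auto
  show thesis
    using someI_ex[OF ex] that unfolding weight_def by blast
qed

definition cozero_in :: "'a topology \<Rightarrow> 'a set \<Rightarrow> bool" where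
  "cozero_in T U \<longleftrightarrow>
     (\<exists>f::'a \<Rightarrow> real. continuous_map T euclideanreal f \<and> U = {x \<in> topspace T. f x \<noteq> 0})"

definition closed_sets :: "'a topology \<Rightarrow> 'a set set" where
  "closed_sets T = {S. closedin T S \<and> S \<noteq> {}}"

definition compact_sets :: "'a topology \<Rightarrow> 'a set set" where
  "compact_sets T = {S. compactin T S \<and> S \<noteq> {}}"

definition closed_connected_sets :: "'a topology \<Rightarrow> 'a set set" where
  "closed_connected_sets T = {S \<in> closed_sets T. connectedin T S}"

definition compact_connected_sets :: "'a topology \<Rightarrow> 'a set set" where
  "compact_connected_sets T = {S \<in> compact_sets T. connectedin T S}"

definition lsc :: "'x topology \<Rightarrow> 'y topology \<Rightarrow> ('x \<Rightarrow> 'y set) \<Rightarrow> bool" where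
  "lsc X Y \<Phi> \<longleftrightarrow> (\<forall>U. openin Y U \<longrightarrow> openin X {x \<in> topspace X. \<Phi> x \<inter> U \<noteq> {}})"

definition usc :: "'x topology \<Rightarrow> 'y topology \<Rightarrow> ('x \<Rightarrow> 'y set) \<Rightarrow> bool" where
  "usc X Y \<Phi> \<longleftrightarrow> (\<forall>F. closedin Y F \<longrightarrow> closedin X {x \<in> topspace X. \<Phi> x \<inter> F \<noteq> {}})"

definition setvalued_continuous :: "'x topology \<Rightarrow> 'y topology \<Rightarrow> ('x \<Rightarrow> 'y set) \<Rightarrow> bool" where
  "setvalued_continuous X Y \<Phi> \<longleftrightarrow> lsc X Y \<Phi> \<and> usc X Y \<Phi>"

definition is_selection :: "'x topology \<Rightarrow> ('x \<Rightarrow> 'y set) \<Rightarrow> ('x \<Rightarrow> 'y set) \<Rightarrow> bool" where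
  "is_selection X \<theta> \<Phi> \<longleftrightarrow> (\<forall>x\<in>topspace X. \<theta> x \<subseteq> \<Phi> x)"

definition metric_nhd :: "'y set \<Rightarrow> ('y \<Rightarrow> 'y \<Rightarrow> real) \<Rightarrow> real \<Rightarrow> 'y set \<Rightarrow> 'y set" where
  "metric_nhd M d \<epsilon> S = (\<Union>y\<in>S. Metric_space.mball M d y \<epsilon>)"

(* The value 0 outside the nonempty compact sets is a convention: Metric_space requires its
   distance to be nonnegative on the whole type, and Inf {} is an unspecified real. *)
definition hausdorff_distance ::
  "'y set \<Rightarrow> ('y \<Rightarrow> 'y \<Rightarrow> real) \<Rightarrow> 'y set \<Rightarrow> 'y set \<Rightarrow> real" where
  "hausdorff_distance M d S T =
     (if S \<in> compact_sets (Metric_space.mtopology M d) \<and> T \<in> compact_sets (Metric_space.mtopology M d)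
      then Inf {\<epsilon>. \<epsilon> > 0 \<and> S \<subseteq> metric_nhd M d \<epsilon> T \<and> T \<subseteq> metric_nhd M d \<epsilon> S}
      else 0)"

(* Meaningful for nonempty bounded sets only; it is applied to images of paths. *)
definition metric_diameter :: "('y \<Rightarrow> 'y \<Rightarrow> real) \<Rightarrow> 'y set \<Rightarrow> real" where
  "metric_diameter d S = Sup {d y z | y z. y \<in> S \<and> z \<in> S}"

definition uniformly_equi_LC0 :: "'y set \<Rightarrow> ('y \<Rightarrow> 'y \<Rightarrow> real) \<Rightarrow> 'y set set \<Rightarrow> bool" where
  "uniformly_equi_LC0 M d \<S> \<longleftrightarrow>
     (\<forall>\<epsilon>>0. \<exists>\<delta>>0. \<forall>S\<in>\<S>. \<forall>y0\<in>S. \<forall>y1\<in>S. d y0 y1 < \<delta> \<longrightarrow>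
        (\<exists>g. pathin (subtopology (Metric_space.mtopology M d) S) g \<and> g 0 = y0 \<and> g 1 = y1 \<and>
             metric_diameter d (g ` {0..1}) < \<epsilon>))"

definition slsf :: "'x topology \<Rightarrow> 'e set \<Rightarrow> ('e \<Rightarrow> 'e \<Rightarrow> real) \<Rightarrow> ('x \<Rightarrow> 'e set) \<Rightarrow> bool" where
  "slsf X E d \<Psi> \<longleftrightarrow>
     (\<forall>F \<epsilon> \<sigma>. closedin X F \<and> \<epsilon> > 0 \<and>
        (\<forall>x\<in>F. \<sigma> x \<in> compact_sets (Metric_space.mtopology E d) \<and> \<sigma> x \<subseteq> \<Psi> x) \<longrightarrow>
        (\<exists>\<U> \<pi>. locally_finite_in (subtopology X F) \<U> \<and> \<Union>\<U> = F \<and>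
           (\<forall>U\<in>\<U>. cozero_in (subtopology X F) U) \<and>
           \<pi> \<in> \<U> \<rightarrow> F \<and>
           |\<U>| \<le>o weight (Metric_space.mtopology E d) \<and>
           (\<forall>U\<in>\<U>. \<forall>x\<in>U. \<sigma> (\<pi> U) \<subseteq> metric_nhd E d \<epsilon> (\<Psi> x))))"

definition cc_between ::
  "'y topology \<Rightarrow> ('x \<Rightarrow> 'y set) \<Rightarrow> ('x \<Rightarrow> 'y set) \<Rightarrow> 'x \<Rightarrow> 'y set set" where
  "cc_between Y \<theta> \<Phi> x = {S \<in> compact_connected_sets Y. \<theta> x \<subseteq> S \<and> S \<subseteq> \<Phi> x}"

context Metric_space
begin

lemma metric_nhd_mono: "\<epsilon> \<le> \<epsilon>' \<Longrightarrow> metric_nhd M d \<epsilon> S \<subseteq> metric_nhd M d \<epsilon>' S"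
  unfolding metric_nhd_def by fastforce

lemma hausdorff_distance_witness:
  assumes "S \<in> compact_sets mtopology" "T \<in> compact_sets mtopology"
  shows "\<exists>\<epsilon>>0. S \<subseteq> metric_nhd M d \<epsilon> T \<and> T \<subseteq> metric_nhd M d \<epsilon> S"
proof -
  have "mbounded (S \<union> T)"
    using assms by (simp add: compact_sets_def compactin_imp_mbounded mbounded_Un)
  then obtain a B where B: "S \<union> T \<subseteq> mcball a B" unfolding mbounded_def by blast
  have d: "d x y < 2 * \<bar>B\<bar> + 1" if "x \<in> S \<union> T" "y \<in> S \<union> T" for x y
  proof -
    have "d a x \<le> B" "d a y \<le> B" "a \<in> M" "x \<in> M" "y \<in> M" using that B by auto
    then show ?thesis using triangle[of x a y] commute[of x a] by auto
  qed
  have M: "S \<subseteq> M" "T \<subseteq> M"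
    using assms compactin_subset_topspace unfolding compact_sets_def by fastforce+
  obtain s t where "s \<in> S" "t \<in> T" using assms unfolding compact_sets_def by blast
  then show ?thesis using M d
    by (intro exI[of _ "2 * \<bar>B\<bar> + 1"]) (auto simp: metric_nhd_def subset_iff)
qed

lemma hausdorff_distance_less:
  assumes "S \<in> compact_sets mtopology" "T \<in> compact_sets mtopology" "hausdorff_distance M d S T < \<epsilon>"
  shows "S \<subseteq> metric_nhd M d \<epsilon> T" "T \<subseteq> metric_nhd M d \<epsilon> S"
proof -
  let ?A = "{\<epsilon>. \<epsilon> > 0 \<and> S \<subseteq> metric_nhd M d \<epsilon> T \<and> T \<subseteq> metric_nhd M d \<epsilon> S}"
  have "?A \<noteq> {}" using hausdorff_distance_witness[OF assms(1,2)] by blast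
  moreover have "Inf ?A < \<epsilon>" using assms unfolding hausdorff_distance_def by simp
  ultimately obtain \<eta> where "\<eta> \<in> ?A" "\<eta> < \<epsilon>" by (metis (lifting) cInf_lessD)
  then show "S \<subseteq> metric_nhd M d \<epsilon> T" "T \<subseteq> metric_nhd M d \<epsilon> S"
    using metric_nhd_mono[of \<eta> \<epsilon>] by fastforce+
qed

lemma hausdorff_distance_le:
  assumes "S \<in> compact_sets mtopology" "T \<in> compact_sets mtopology" "\<epsilon> > 0"
    "S \<subseteq> metric_nhd M d \<epsilon> T" "T \<subseteq> metric_nhd M d \<epsilon> S"
  shows "hausdorff_distance M d S T \<le> \<epsilon>"
proof -
  let ?A = "{\<epsilon>. \<epsilon> > 0 \<and> S \<subseteq> metric_nhd M d \<epsilon> T \<and> T \<subseteq> metric_nhd M d \<epsilon> S}"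
  have "bdd_below ?A" by (rule bdd_belowI[of _ 0]) auto
  then have "Inf ?A \<le> \<epsilon>" by (rule cInf_lower[rotated]) (use assms in auto)
  then show ?thesis using assms by (simp add: hausdorff_distance_def)
qed

lemma metric_nhd_trans:
  assumes "S \<subseteq> metric_nhd M d \<epsilon> T" "T \<subseteq> metric_nhd M d \<eta> R"
  shows "S \<subseteq> metric_nhd M d (\<epsilon> + \<eta>) R"
proof
  fix s assume "s \<in> S"
  then obtain t where t: "t \<in> T" "t \<in> M" "s \<in> M" "d t s < \<epsilon>"
    using assms(1) unfolding metric_nhd_def by auto
  then obtain r where "r \<in> R" "r \<in> M" "d r t < \<eta>"
    using assms(2) unfolding metric_nhd_def by force
  with t triangle[of r t s] show "s \<in> metric_nhd M d (\<epsilon> + \<eta>) R"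
    unfolding metric_nhd_def by force
qed

lemma subset_if_metric_nhd:
  assumes T: "T \<in> compact_sets mtopology" and sub: "\<And>\<epsilon>. \<epsilon> > 0 \<Longrightarrow> S \<subseteq> metric_nhd M d \<epsilon> T"
  shows "S \<subseteq> T"
proof
  fix s assume s: "s \<in> S"
  have M: "s \<in> M" using sub[of 1] s unfolding metric_nhd_def by auto
  have "closedin mtopology T"
    using T unfolding compact_sets_def by (simp add: compactin_imp_closedin Hausdorff_space_mtopology)
  moreover have "\<forall>r>0. \<exists>y\<in>T. y \<in> mball s r"
  proof (intro allI impI)
    fix r :: real assume "r > 0"
    then have "s \<in> metric_nhd M d r T" using sub s by blast
    then show "\<exists>y\<in>T. y \<in> mball s r" unfolding metric_nhd_def by (auto simp: commute)
  qed
  ultimately show "s \<in> T"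
    using M closure_of_closedin[of mtopology T] metric_closure_of[of T] by blast
qed

proposition Metric_space_hausdorff_distance:
  "Metric_space (compact_sets mtopology) (hausdorff_distance M d)"
proof
  let ?C = "compact_sets mtopology" and ?H = "hausdorff_distance M d"
  show nn: "0 \<le> ?H S T" for S T
  proof (cases "S \<in> ?C \<and> T \<in> ?C")
    case True
    then show ?thesis
      using hausdorff_distance_witness[of S T]
      by (auto simp: hausdorff_distance_def intro!: cInf_greatest)
  qed (auto simp: hausdorff_distance_def)
  show "?H S T = ?H T S" for S T
    unfolding hausdorff_distance_def by (simp add: conj_commute)
  show "?H S T = 0 \<longleftrightarrow> S = T" if SC: "S \<in> ?C" and TC: "T \<in> ?C" for S T
  proof
    assume "?H S T = 0"
    then show "S = T"
      using hausdorff_distance_less[OF SC TC] subset_if_metric_nhd SC TC by (simp add: subset_antisym)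
  next
    assume eq: "S = T"
    have M: "S \<subseteq> M"
      using SC compactin_subset_topspace[of mtopology S] unfolding compact_sets_def by simp
    have "?H S S \<le> 0 + \<epsilon>" if e: "\<epsilon> > 0" for \<epsilon>
    proof -
      have "S \<subseteq> metric_nhd M d \<epsilon> S"
        unfolding metric_nhd_def using M e by (intro subsetI UN_I centre_in_mball_iff[THEN iffD2]) auto
      then show ?thesis using hausdorff_distance_le[OF SC SC e] by simp
    qed
    then have "?H S S \<le> 0" by (rule field_le_epsilon)
    then show "?H S T = 0" using nn[of S S] eq by simp
  qed
  show "?H S R \<le> ?H S T + ?H T R" if "S \<in> ?C" "T \<in> ?C" "R \<in> ?C" for S T R
  proof (rule field_le_epsilon)
    fix e :: real assume e: "e > 0"
    let ?a = "?H S T + e/2" and ?b = "?H T R + e/2"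
    have 1: "S \<subseteq> metric_nhd M d ?a T" "T \<subseteq> metric_nhd M d ?a S"
      using hausdorff_distance_less[of S T ?a] that e by auto
    have 2: "T \<subseteq> metric_nhd M d ?b R" "R \<subseteq> metric_nhd M d ?b T"
      using hausdorff_distance_less[of T R ?b] that e by auto
    have "?H S R \<le> ?a + ?b"
    proof (rule hausdorff_distance_le)
      show "?a + ?b > 0" using nn[of S T] nn[of T R] e by linarith
      show "S \<subseteq> metric_nhd M d (?a + ?b) R" by (rule metric_nhd_trans[OF 1(1) 2(1)])
      show "R \<subseteq> metric_nhd M d (?a + ?b) S"
        using metric_nhd_trans[OF 2(2) 1(2)] by (simp add: add.commute)
    qed (use that in auto)
    then show "?H S R \<le> ?H S T + ?H T R + e" by simp
  qed
qed

end

end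

theory Submission
  imports Defs
begin

text \<open>The selection \<open>\<phi>\<close> is a uniform limit of maps with finite values. Since \<open>\<Phi>\<close> is uniformly
  equi-\<open>LC\<^sup>0\<close>, a finite set which is chain-connected at a small scale, lies near \<open>\<Phi> x\<close> and nearly
  contains \<open>\<theta> x\<close> is Hausdorff-close to a continuum between \<open>\<theta> x\<close> and \<open>\<Phi> x\<close>. So instead of continuous maps one
  may work with finite-valued ones whose jumps are small, and no order arcs in the hyperspace are needed.

  Given such a map, choose continua \<open>S x\<close> near its values. Strong lower semi-factorizability provides a
  locally finite cozero cover and continua \<open>S (p V)\<close> that are good approximations on all of \<open>V\<close>; these are replaced
  by finite nets \<open>R V\<close>. To pass from one \<open>V\<close> to another by small jumps, let the net of \<open>V\<close> be entered gradually
  as the cozero function of \<open>V\<close> grows: the new value at \<open>x\<close> consists of the points that can be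
  reached by small steps through the nets of the members around \<open>x\<close>, starting in a member of maximal
  weight, at total cost at most 1, where a step in the net of \<open>V\<close> costs \<open>2 (1 - \<lambda> V x)\<close>. All these nets come
  close to \<open>\<theta> x\<close>, hence touch each other, and no common base point is required.\<close>

section \<open>Chains and discrete approximations of continua\<close>

text \<open>The union of the nets of all members containing \<open>x\<close> would jump whenever
  \<open>x\<close> enters a member, since a whole net appears at once. The budget prevents this: a
  member \<open>V\<close> with \<open>\<lambda> V x < 1/2\<close> cannot be entered at all, and
  beyond that its net opens up only as its price falls. After a small change of prices, every
  endpoint of an affordable walk is still within one step of an endpoint that is affordable under
  the new prices, and one step is shorter than the current scale. How small the change must be
  depends on the sizes of the nets nearby, so the next cover is cut out by the prices themselves;
  each stage therefore carries a cover along with its map. New values stay near old ones because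
  every net is sampled from a continuum \<open>S y\<close> with \<open>y\<close> in the same old
  member as \<open>x\<close>. Connectedness and the two inclusions hold at each stage only up to a
  scale tending to 0; completeness makes them exact in the limit.\<close>

definition link :: "('a \<Rightarrow> 'a \<Rightarrow> real) \<Rightarrow> real \<Rightarrow> 'a set \<Rightarrow> ('a \<times> 'a) set" where
  "link d e K = {(u, v). u \<in> K \<and> v \<in> K \<and> d u v < e}"

text \<open>This is Cantor's well-chainedness at one scale, with chains staying inside
  \<open>K\<close>. The empty set qualifies, so nonemptiness is demanded separately where it
  matters.\<close>

definition chained :: "('a \<Rightarrow> 'a \<Rightarrow> real) \<Rightarrow> real \<Rightarrow> 'a set \<Rightarrow> bool" where
  "chained d e K \<longleftrightarrow> (\<forall>a\<in>K. \<forall>b\<in>K. (a, b) \<in> (link d e K)\<^sup>*)"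

lemma link_mono: "K \<subseteq> L \<Longrightarrow> e \<le> e' \<Longrightarrow> link d e K \<subseteq> link d e' L"
  by (auto simp: link_def)

lemma chained_imp_rtrancl:
  assumes "chained d e K" "a \<in> K" "b \<in> K" "K \<subseteq> L" "e \<le> e'"
  shows "(a, b) \<in> (link d e' L)\<^sup>*"
  using rtrancl_mono[OF link_mono[OF assms(4,5)], of d] assms(1-3) unfolding chained_def by blast

lemma chained_mono: "chained d e K \<Longrightarrow> e \<le> e' \<Longrightarrow> chained d e' K"
  unfolding chained_def[of d e'] by (blast intro: chained_imp_rtrancl)

context Metric_space
begin

abbreviation nhd :: "real \<Rightarrow> 'a set \<Rightarrow> 'a set" where
  "nhd \<equiv> metric_nhd M d"

lemma in_nhd: "z \<in> nhd e A \<longleftrightarrow> (\<exists>a\<in>A. a \<in> M \<and> z \<in> M \<and> d a z < e)"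
  by (auto simp: metric_nhd_def)

lemma subset_nhdD: "A \<subseteq> nhd e B \<Longrightarrow> a \<in> A \<Longrightarrow> \<exists>b\<in>B. b \<in> M \<and> a \<in> M \<and> d b a < e"
  by (auto simp: in_nhd subset_iff)

lemma subset_nhd_self: "A \<subseteq> M \<Longrightarrow> e > 0 \<Longrightarrow> A \<subseteq> nhd e A"
  by (force simp: in_nhd)

lemma nhd_subset_carrier: "nhd e A \<subseteq> M"
  by (auto simp: in_nhd)

lemma subset_nhd_mono: "A \<subseteq> nhd e B \<Longrightarrow> B \<subseteq> C \<Longrightarrow> e \<le> e' \<Longrightarrow> A \<subseteq> nhd e' C"
  by (fastforce simp: in_nhd)

lemma link_sym: "sym (link d e K)"
  by (auto simp: link_def sym_def commute)

lemma rtrancl_link_sym: "(a, b) \<in> (link d e K)\<^sup>* \<Longrightarrow> (b, a) \<in> (link d e K)\<^sup>*"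
  by (meson link_sym sym_rtrancl symD)

lemma chainedI_base:
  assumes "\<And>b. b \<in> K \<Longrightarrow> (a, b) \<in> (link d e K)\<^sup>*"
  shows "chained d e K"
  unfolding chained_def using assms rtrancl_link_sym rtrancl_trans by metis

text \<open>The points reachable from \<open>a\<close> and the remaining points of \<open>C\<close>
  have open \<open>e\<close>-neighbourhoods that do not meet inside \<open>C\<close>, since a common
  point would link the two classes. Connectedness leaves the second class empty.\<close>

lemma connectedin_imp_chained:
  assumes "connectedin mtopology C" "e > 0"
  shows "chained d e C"
proof (cases "C = {}")
  case False
  then obtain a where a: "a \<in> C" by auto
  have CM: "C \<subseteq> M" using assms connectedin_subset_topspace by fastforce
  define A where "A = {b \<in> C. (a, b) \<in> (link d e C)\<^sup>*}"
  define U where "U = nhd e A"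
  define V where "V = nhd e (C - A)"
  have op: "openin mtopology U" "openin mtopology V"
    unfolding U_def V_def metric_nhd_def by (auto intro: openin_Union)
  have "C \<subseteq> U \<union> V"
    unfolding U_def V_def using CM assms(2) by (force simp: in_nhd)
  have UA: "C \<inter> U \<subseteq> A"
  proof
    fix z assume z: "z \<in> C \<inter> U"
    then obtain b where b: "b \<in> A" "d b z < e" by (auto simp: U_def in_nhd)
    then have "(b, z) \<in> link d e C" using z by (auto simp: link_def A_def)
    with b z show "z \<in> A" by (auto simp: A_def)
  qed
  have VA: "C \<inter> V \<subseteq> C - A"
  proof
    fix z assume z: "z \<in> C \<inter> V"
    then obtain b where b: "b \<in> C" "b \<notin> A" "d b z < e" by (auto simp: V_def in_nhd)
    then have "(z, b) \<in> link d e C" using z by (auto simp: link_def commute)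
    then have "z \<notin> A" using b by (auto simp: A_def intro: rtrancl.rtrancl_into_rtrancl)
    with z show "z \<in> C - A" by auto
  qed
  have "a \<in> U \<inter> C"
    using a CM assms(2) by (force simp: U_def A_def in_nhd)
  have "V \<inter> C = {}"
  proof -
    have "U \<inter> V \<inter> C = {}" using UA VA by blast
    with \<open>C \<subseteq> U \<union> V\<close> \<open>a \<in> U \<inter> C\<close> show ?thesis
      using assms(1) op unfolding connectedin by blast
  qed
  then have "C \<subseteq> A"
    using \<open>C \<subseteq> U \<union> V\<close> UA by blast
  then show ?thesis
    by (intro chainedI_base[of _ a]) (auto simp: A_def)
qed (auto simp: chained_def)

text \<open>A Lebesgue number of the one-element cover of \<open>A\<close> by \<open>M - F\<close>
  serves as the gap.\<close>

lemma compactin_closedin_gap: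
  assumes "compactin mtopology A" "closedin mtopology F" "A \<inter> F = {}"
  shows "\<exists>e>0. \<forall>a\<in>A. \<forall>b\<in>F. e \<le> d a b"
proof -
  have AM: "A \<subseteq> M" using assms(1) compactin_subset_topspace by fastforce
  have FM: "F \<subseteq> M" using assms(2) closedin_subset by fastforce
  have "openin mtopology (M - F)" using assms(2) by (auto simp: closedin_def)
  moreover have "A \<subseteq> \<Union>{M - F}" using AM assms(3) by auto
  ultimately obtain e where e: "e > 0" "\<forall>x\<in>A. \<exists>U\<in>{M - F}. mball x e \<subseteq> U"
    using lebesgue_number[OF assms(1), of "{M - F}"] by blast
  have "e \<le> d a b" if "a \<in> A" "b \<in> F" for a b
  proof (rule ccontr)
    assume "\<not> e \<le> d a b"
    then have "b \<in> mball a e" using that AM FM by auto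
    then show False using e that by blast
  qed
  with e show ?thesis by blast
qed

text \<open>A separation of the compact set \<open>T\<close> leaves a positive gap between its
  pieces, and a chain with links shorter than the gap cannot pass from one piece to the
  other.\<close>

lemma chained_imp_connectedin:
  assumes "compactin mtopology T" "\<And>e. e > 0 \<Longrightarrow> chained d e T"
  shows "connectedin mtopology T"
  unfolding connectedin_closedin
proof (intro conjI notI)
  show "T \<subseteq> topspace mtopology"
    using assms(1) compactin_subset_topspace by blast
  assume "\<exists>E1 E2. closedin mtopology E1 \<and> closedin mtopology E2 \<and>
            T \<subseteq> E1 \<union> E2 \<and> E1 \<inter> E2 \<inter> T = {} \<and> E1 \<inter> T \<noteq> {} \<and> E2 \<inter> T \<noteq> {}"
  then obtain E1 E2 where E: "closedin mtopology E1" "closedin mtopology E2"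
            "T \<subseteq> E1 \<union> E2" "E1 \<inter> E2 \<inter> T = {}" "E1 \<inter> T \<noteq> {}" "E2 \<inter> T \<noteq> {}" by blast
  have "compactin mtopology (E1 \<inter> T)"
    using E(1) assms(1) by (simp add: closed_Int_compactin)
  moreover have "(E1 \<inter> T) \<inter> E2 = {}" using E by blast
  ultimately obtain e where e: "e > 0" "\<forall>a\<in>E1 \<inter> T. \<forall>b\<in>E2. e \<le> d a b"
    using compactin_closedin_gap E(2) by blast
  obtain a b where ab: "a \<in> E1 \<inter> T" "b \<in> E2 \<inter> T" using E by blast
  have "(a, b) \<in> (link d e T)\<^sup>*" using assms(2)[OF e(1)] ab by (auto simp: chained_def)
  then have "b \<in> E1 \<inter> T"
  proof (induction rule: rtrancl_induct)
    case (step y z)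
    then have "z \<in> T" "z \<notin> E2" using e by (auto simp: link_def not_le[symmetric])
    then show ?case using E by blast
  qed (use ab in auto)
  then show False using ab E by blast
qed

lemma chained_subset_finite:
  assumes "(a, b) \<in> (link d e C)\<^sup>*" "a \<in> C"
  shows "\<exists>K. finite K \<and> K \<subseteq> C \<and> a \<in> K \<and> b \<in> K \<and> chained d e K"
  using assms(1)
proof (induction rule: rtrancl_induct)
  case base
  then show ?case using assms(2) by (intro exI[of _ "{a}"]) (auto simp: chained_def)
next
  case (step b c)
  then obtain K where K: "finite K" "K \<subseteq> C" "a \<in> K" "b \<in> K" "chained d e K" by blast
  have "chained d e (insert c K)"
  proof (rule chainedI_base[of _ b])
    fix x assume x: "x \<in> insert c K"
    show "(b, x) \<in> (link d e (insert c K))\<^sup>*"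
    proof (cases "x = c")
      case True
      then have "(b, x) \<in> link d e (insert c K)" using step K by (auto simp: link_def)
      then show ?thesis by auto
    next
      case False
      then show ?thesis using chained_imp_rtrancl[OF K(5,4), of x "insert c K" e] x by auto
    qed
  qed
  with K step show ?case by (intro exI[of _ "insert c K"]) (auto simp: link_def)
qed

section \<open>Hausdorff closeness and limits of discrete continua\<close>

definition hclose :: "real \<Rightarrow> 'a set \<Rightarrow> 'a set \<Rightarrow> bool" where
  "hclose e A B \<longleftrightarrow> A \<subseteq> nhd e B \<and> B \<subseteq> nhd e A"

lemma hclose_sym: "hclose e A B \<Longrightarrow> hclose e B A"
  by (auto simp: hclose_def)

lemma hclose_trans: "hclose e A B \<Longrightarrow> hclose e' B C \<Longrightarrow> hclose (e + e') A C"
  unfolding hclose_def using metric_nhd_trans[of A e B e' C] metric_nhd_trans[of C e' B e A]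
  by (simp add: add.commute)

lemma hclose_mono: "hclose e A B \<Longrightarrow> e \<le> e' \<Longrightarrow> hclose e' A B"
  unfolding hclose_def by (meson metric_nhd_mono order_trans)

text \<open>A link of \<open>K\<close> is carried over to \<open>T\<close> by moving each of its
  ends by less than \<open>r\<close>.\<close>

lemma chained_hclose:
  assumes "chained d e K" "hclose r T K" "0 \<le> e"
  shows "chained d (e + 2 * r) T"
proof -
  have KT: "K \<subseteq> nhd r T" and TK: "T \<subseteq> nhd r K" using assms(2) by (auto simp: hclose_def)
  have TM: "T \<subseteq> M" and KM: "K \<subseteq> M" using KT TK by (meson nhd_subset_carrier order_trans)+
  \<comment> \<open>A point of \<open>K\<close> may have several partners in \<open>T\<close>, hence
    the freedom in \<open>s\<close> and \<open>t\<close>; the base case joins two partners of the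
    same point.\<close>
  have near: "(s, t) \<in> (link d (e + 2 * r) T)\<^sup>*"
    if "(a, b) \<in> (link d e K)\<^sup>*" "a \<in> K" "s \<in> T" "d a s < r" "t \<in> T" "d b t < r" for a b s t
    using that(1,5,6)
  proof (induction arbitrary: t rule: rtrancl_induct)
    case base
    have M: "s \<in> M" "t \<in> M" "a \<in> M" using that base TM KM by auto
    then have "d s t \<le> d a s + d a t" using triangle[of s a t] commute by simp
    also have "\<dots> < e + 2 * r" using that base \<open>0 \<le> e\<close> by linarith
    finally have "(s, t) \<in> link d (e + 2 * r) T" using that base by (simp add: link_def)
    then show ?case by auto
  next
    case (step b b')
    have bb: "b \<in> K" "b' \<in> K" "d b b' < e" using step by (auto simp: link_def)
    then obtain u where u: "u \<in> T" "d b u < r" using subset_nhdD[OF KT] commute by metis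
    have M: "u \<in> M" "t \<in> M" "b \<in> M" "b' \<in> M" using bb u step TM KM by auto
    have "d u t \<le> d u b + d b b' + d b' t"
      using triangle[of u b t] triangle[of b b' t] M by linarith
    also have "\<dots> < e + 2 * r" using bb u step commute[of u b] by linarith
    finally have "(u, t) \<in> link d (e + 2 * r) T" using u step by (simp add: link_def)
    then show ?case using step.IH[OF u] by auto
  qed
  show ?thesis
    unfolding chained_def
  proof (intro ballI)
    fix s t assume st: "s \<in> T" "t \<in> T"
    then obtain a b where "a \<in> K" "b \<in> K" "d a s < r" "d b t < r"
      using subset_nhdD[OF TK] by meson
    then show "(s, t) \<in> (link d (e + 2 * r) T)\<^sup>*"
      using near[of a b s t] assms(1) st by (auto simp: chained_def)
  qed
qed

text \<open>A discrete stand-in, at scale \<open>\<delta>\<close>, for a continuum between \<open>\<theta>\<close> and \<open>S\<close>.\<close>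

definition quasi_continuum :: "real \<Rightarrow> 'a set \<Rightarrow> 'a set \<Rightarrow> 'a set \<Rightarrow> bool" where
  "quasi_continuum \<delta> S \<theta> K \<longleftrightarrow>
     finite K \<and> K \<noteq> {} \<and> K \<subseteq> nhd \<delta> S \<and> \<theta> \<subseteq> nhd \<delta> K \<and> chained d \<delta> K"

lemma quasi_continuum_subset: "quasi_continuum \<delta> S \<theta> K \<Longrightarrow> K \<subseteq> M"
  unfolding quasi_continuum_def by (meson nhd_subset_carrier order_trans)

lemma quasi_continuum_mono:
  "quasi_continuum \<delta> S \<theta> K \<Longrightarrow> \<delta> \<le> \<delta>' \<Longrightarrow> quasi_continuum \<delta>' S \<theta> K"
  unfolding quasi_continuum_def by (meson chained_mono metric_nhd_mono order_trans)

text \<open>The sets \<open>K n\<close> form a Cauchy sequence in the Hausdorff sense. Finite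
  approximations make the limit totally bounded, completeness makes it compact, and
  \<open>chained_hclose\<close> makes it chained at every scale, hence connected.\<close>

lemma quasi_continua_limit:
  assumes "mcomplete" and S: "closedin mtopology S"
    and K: "\<And>n. quasi_continuum (\<delta> n) S \<theta> (K n)" and \<delta>: "\<delta> \<longlonglongrightarrow> 0"
    and close: "\<And>n. hclose (c / 2^n) (K n) (K (Suc n))" and c: "c > 0"
  shows "\<exists>T\<in>compact_connected_sets mtopology. \<theta> \<subseteq> T \<and> T \<subseteq> S \<and> (\<forall>n. hclose (4 * c / 2^n) T (K n))"
proof -
  \<comment> \<open>This is the Kuratowski lower limit of the sets \<open>K n\<close>. Closedness
    and the inclusions follow directly from it; that every point of \<open>K n\<close> has a point
    of \<open>T\<close> nearby requires a construction.\<close>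
  define T where "T = {y \<in> M. \<forall>e>0. \<exists>N. \<forall>n\<ge>N. y \<in> nhd e (K n)}"
  have KM: "K n \<subseteq> M" for n using quasi_continuum_subset[OF K] .
  have pow: "\<exists>N. \<forall>n\<ge>N. C / 2^n < e" if "e > 0" for C e :: real
  proof -
    have "(\<lambda>n. C / 2^n) \<longlonglongrightarrow> 0" by (rule LIMSEQ_divide_realpow_zero) simp
    from order_tendstoD(2)[OF this that] have "eventually (\<lambda>n. C / 2^n < e) sequentially" .
    then show ?thesis by (simp add: eventually_sequentially)
  qed
  \<comment> \<open>The geometric sum of the first \<open>k\<close> radii is
    \<open>2 * c / 2^n - 2 * c / 2^(n + k)\<close>. The additional \<open>c / 2^n\<close> keeps the
    radius positive for \<open>k = 0\<close>.\<close>
  have down: "K (n + k) \<subseteq> nhd (3 * c / 2^n - 2 * c / 2^(n + k)) (K n)" for n k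
  proof (induction k)
    case 0
    then show ?case using subset_nhd_self[OF KM] c by (simp add: field_simps)
  next
    case (Suc k)
    have "K (n + Suc k) \<subseteq> nhd (c / 2^(n + k)) (K (n + k))"
      using close[of "n + k"] by (simp add: hclose_def)
    from metric_nhd_trans[OF this Suc] show ?case
      by (simp add: field_simps)
  qed
  have down': "K m \<subseteq> nhd (3 * c / 2^n) (K n)" if "m \<ge> n" for n m
  proof -
    have "K m \<subseteq> nhd (3 * c / 2^n - 2 * c / 2^m) (K n)"
      using down[of n "m - n"] that by simp
    moreover have "3 * c / 2^n - 2 * c / 2^m \<le> 3 * c / 2^n" using c by simp
    ultimately show ?thesis using metric_nhd_mono by blast
  qed
  have TK: "T \<subseteq> nhd (4 * c / 2^n) (K n)" for n
  proof
    fix y assume "y \<in> T"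
    moreover have "c / 2^n > 0" using c by simp
    ultimately obtain N where "\<forall>m\<ge>N. y \<in> nhd (c / 2^n) (K m)"
      unfolding T_def by blast
    then have "{y} \<subseteq> nhd (c / 2^n) (K (max N n))" by simp
    from metric_nhd_trans[OF this down'[of n "max N n"]] show "y \<in> nhd (4 * c / 2^n) (K n)"
      by (simp add: field_simps)
  qed
  have r8: "8 * c / 2^n = 4 * c / 2^n + 4 * c / 2^n" for n :: nat by (simp add: field_simps)
  have KT: "K n \<subseteq> nhd (4 * c / 2^n) T" for n
  proof
    fix k assume k: "k \<in> K n"
    \<comment> \<open>Starting at \<open>k\<close>, one point is followed through the successive
      sets; the resulting sequence is Cauchy and its limit is a point of \<open>T\<close> near
      \<open>k\<close>.\<close>
    have "\<exists>s. \<forall>i. (s i \<in> K (n + i) \<and> (i = 0 \<longrightarrow> s i = k)) \<and> d (s i) (s (Suc i)) < c / 2^(n + i)"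
    proof (rule dependent_nat_choice)
      show "\<exists>x. x \<in> K (n + 0) \<and> (0 = (0::nat) \<longrightarrow> x = k)" using k by auto
      fix x i assume "x \<in> K (n + i) \<and> (i = 0 \<longrightarrow> x = k)"
      then have "x \<in> nhd (c / 2^(n + i)) (K (Suc (n + i)))"
        using close[of "n + i"] by (auto simp: hclose_def)
      then show "\<exists>y. (y \<in> K (n + Suc i) \<and> (Suc i = 0 \<longrightarrow> y = k)) \<and> d x y < c / 2^(n + i)"
        by (auto simp: in_nhd commute)
    qed
    then obtain s where s: "\<And>i. s i \<in> K (n + i)" "s 0 = k" "\<And>i. d (s i) (s (Suc i)) < c / 2^(n + i)"
      by blast
    have sM: "s i \<in> M" for i using s(1) KM by blast
    have step: "d (s i) (s (i + j)) \<le> 2 * c / 2^(n + i) - 2 * c / 2^(n + i + j)" for i j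
    proof (induction j)
      case 0
      then show ?case using sM by simp
    next
      case (Suc j)
      have "d (s i) (s (i + Suc j)) \<le> d (s i) (s (i + j)) + d (s (i + j)) (s (Suc (i + j)))"
        using triangle sM by simp
      also have "\<dots> \<le> 2 * c / 2^(n + i) - 2 * c / 2^(n + i + j) + c / 2^(n + (i + j))"
        using Suc s(3)[of "i + j"] by linarith
      also have "\<dots> = 2 * c / 2^(n + i) - 2 * c / 2^(n + i + Suc j)"
        by (simp add: field_simps)
      finally show ?case .
    qed
    have step': "d (s i) (s j) \<le> 2 * c / 2^(n + i)" if "i \<le> j" for i j
    proof -
      have "0 \<le> 2 * c / 2^(n + j)" using c by simp
      then show ?thesis using step[of i "j - i"] that by simp
    qed
    have "MCauchy s"
      unfolding MCauchy_def
    proof (intro conjI allI impI)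
      show "range s \<subseteq> M" using sM by auto
      fix e :: real assume "e > 0"
      then obtain N where N: "\<forall>m\<ge>N. 2 * c / 2^m < e" using pow by blast
      have "d (s i) (s j) < e" if "N \<le> i" "N \<le> j" for i j
      proof (cases "i \<le> j")
        case True
        then show ?thesis using step'[OF True] N that
          by (meson le_add2 le_less_trans order_trans)
      next
        case False
        then show ?thesis using step'[of j i] N that commute
          by (metis le_add2 le_less_trans nat_le_linear order_trans)
      qed
      then show "\<exists>N. \<forall>i j. N \<le> i \<longrightarrow> N \<le> j \<longrightarrow> d (s i) (s j) < e" by blast
    qed
    then obtain y where y: "limitin mtopology s y sequentially"
      using assms(1) unfolding mcomplete_def by blast
    have yM: "y \<in> M" using y limitin_mspace by blast
    have lim: "\<exists>N. \<forall>i\<ge>N. d (s i) y < e" if "e > 0" for e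
      using y that unfolding limit_metric_sequentially by blast
    have "y \<in> T"
      unfolding T_def
    proof (intro CollectI conjI allI impI yM)
      fix e :: real assume "e > 0"
      then obtain N where N: "\<forall>i\<ge>N. d (s i) y < e" using lim by blast
      have "y \<in> nhd e (K m)" if m: "m \<ge> N + n" for m
      proof -
        have "s (m - n) \<in> K m" "d (s (m - n)) y < e" using s(1)[of "m - n"] N m by auto
        then show ?thesis using sM yM by (auto simp: in_nhd)
      qed
      then show "\<exists>N. \<forall>m\<ge>N. y \<in> nhd e (K m)" by blast
    qed
    moreover have "d y k < 4 * c / 2^n"
    proof -
      obtain i where i: "d (s i) y < c / 2^n" using lim[of "c / 2^n"] c by auto
      have "d k y \<le> d k (s i) + d (s i) y" using triangle sM yM s(2) by metis
      also have "\<dots> < 2 * c / 2^n + c / 2^n" using step'[of 0 i] s(2) i by simp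
      also have "\<dots> \<le> 4 * c / 2^n" using c by (simp add: field_simps)
      finally show ?thesis by (simp add: commute)
    qed
    ultimately show "k \<in> nhd (4 * c / 2^n) T"
      using yM KM k by (auto simp: in_nhd)
  qed
  have TM: "T \<subseteq> M" by (auto simp: T_def)
  have hc: "hclose (4 * c / 2^n) T (K n)" for n using TK KT by (simp add: hclose_def)
  have Tne: "T \<noteq> {}" using KT[of 0] K[of 0] by (auto simp: quasi_continuum_def in_nhd)
  have "mtotally_bounded T"
    unfolding mtotally_bounded_def
  proof (intro allI impI)
    fix e :: real assume "e > 0"
    then obtain n where n: "8 * c / 2^n < e" using pow[of e "8 * c"] by blast
    \<comment> \<open>The centres have to lie in \<open>T\<close>, so the points of
      \<open>K n\<close> are moved there; this doubles the radius
      \<open>4 * c / 2^n\<close>.\<close>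
    have "\<forall>k\<in>K n. \<exists>t\<in>T. d t k < 4 * c / 2^n" using subset_nhdD[OF KT[of n]] by blast
    then obtain t where t: "\<And>k. k \<in> K n \<Longrightarrow> t k \<in> T \<and> d (t k) k < 4 * c / 2^n" by metis
    have "T \<subseteq> (\<Union>x\<in>t ` K n. mball x e)"
    proof
      fix y assume y: "y \<in> T"
      then obtain k where k: "k \<in> K n" "d k y < 4 * c / 2^n" using subset_nhdD[OF TK[of n]] by blast
      have M: "t k \<in> M" "k \<in> M" "y \<in> M" using t k y TM KM by auto
      have "d (t k) y \<le> d (t k) k + d k y" using triangle M by blast
      also have "\<dots> < e" using t[OF k(1)] k n r8[of n] by linarith
      finally show "y \<in> (\<Union>x\<in>t ` K n. mball x e)" using k M by auto
    qed
    then show "\<exists>K. finite K \<and> K \<subseteq> T \<and> T \<subseteq> (\<Union>x\<in>K. mball x e)"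
      using t K[of n] by (intro exI[of _ "t ` K n"]) (auto simp: quasi_continuum_def)
  qed
  moreover have "mtopology closure_of T = T"
  proof
    show "mtopology closure_of T \<subseteq> T"
    proof
      fix y assume y: "y \<in> mtopology closure_of T"
      then have yM: "y \<in> M" by (simp add: metric_closure_of)
      show "y \<in> T"
        unfolding T_def
      proof (intro CollectI conjI allI impI yM)
        fix e :: real assume e: "e > 0"
        then obtain t where t: "t \<in> T" "d y t < e/2"
          using y unfolding metric_closure_of by (auto dest!: spec[of _ "e/2"])
        have "e/2 > 0" using e by simp
        with t obtain N where N: "\<forall>n\<ge>N. t \<in> nhd (e/2) (K n)"
          unfolding T_def by blast
        have "{y} \<subseteq> nhd (e/2) {t}" using t yM TM by (auto simp: in_nhd commute)
        then show "\<exists>N. \<forall>n\<ge>N. y \<in> nhd e (K n)"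
          using metric_nhd_trans[of "{y}" "e/2" "{t}" "e/2"] N by fastforce
      qed
    qed
  qed (simp add: TM closure_of_subset)
  ultimately have comp: "compactin mtopology T"
    using mtotally_bounded_eq_compact_closure_of[OF assms(1)] by metis
  have "connectedin mtopology T"
  proof (rule chained_imp_connectedin[OF comp])
    fix e :: real assume e: "e > 0"
    \<comment> \<open>One half of \<open>e\<close> is reserved for the links of \<open>K n\<close>,
      the other for the displacement at their two ends.\<close>
    obtain n where n: "8 * c / 2^n < e/2" "\<delta> n < e/2"
    proof -
      obtain N1 where "\<forall>m\<ge>N1. 8 * c / 2^m < e/2" using pow[of "e/2" "8 * c"] e by auto
      moreover obtain N2 where "\<forall>m\<ge>N2. \<delta> m < e/2"
        using order_tendstoD(2)[OF \<delta>, of "e/2"] e by (auto simp: eventually_sequentially)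
      ultimately show ?thesis using that[of "max N1 N2"] by auto
    qed
    have "chained d (e/2) (K n)"
      using K[of n] n(2) chained_mono unfolding quasi_continuum_def by (meson less_imp_le)
    from chained_hclose[OF this hc] e have "chained d (e/2 + 2 * (4 * c / 2^n)) T" by simp
    then show "chained d e T" by (rule chained_mono) (use n(1) r8[of n] in linarith)
  qed
  with comp Tne have "T \<in> compact_connected_sets mtopology"
    by (simp add: compact_connected_sets_def compact_sets_def)
  moreover have "\<theta> \<subseteq> T"
  proof
    fix y assume y: "y \<in> \<theta>"
    have y\<theta>: "y \<in> nhd (\<delta> m) (K m)" for m using y K[of m] by (auto simp: quasi_continuum_def)
    then have yM: "y \<in> M" using nhd_subset_carrier by blast
    show "y \<in> T"
      unfolding T_def
    proof (intro CollectI conjI allI impI yM)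
      fix e :: real assume "e > 0"
      then obtain N where N: "\<forall>m\<ge>N. \<delta> m < e"
        using order_tendstoD(2)[OF \<delta>] by (auto simp: eventually_sequentially)
      have "y \<in> nhd e (K m)" if "m \<ge> N" for m
        using y\<theta>[of m] N that metric_nhd_mono[of "\<delta> m" e] by fastforce
      then show "\<exists>N. \<forall>m\<ge>N. y \<in> nhd e (K m)" by blast
    qed
  qed
  moreover have "T \<subseteq> S"
  proof
    fix y assume y: "y \<in> T"
    have "\<exists>z\<in>S. z \<in> mball y e" if e: "e > 0" for e
    proof -
      have "e/2 > 0" using e by simp
      with y obtain N1 where N1: "\<forall>n\<ge>N1. y \<in> nhd (e/2) (K n)"
        unfolding T_def by blast
      obtain N2 where N2: "\<forall>m\<ge>N2. \<delta> m < e/2"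
        using order_tendstoD(2)[OF \<delta>, of "e/2"] e by (auto simp: eventually_sequentially)
      let ?n = "max N1 N2"
      have "K ?n \<subseteq> nhd (e/2) S"
        using K[of ?n] N2 metric_nhd_mono[of "\<delta> ?n" "e/2" S]
        unfolding quasi_continuum_def by (meson less_imp_le max.cobounded2 order_trans)
      then have "{y} \<subseteq> nhd (e/2 + e/2) S"
        using N1 by (intro metric_nhd_trans[of "{y}" "e/2" "K ?n" "e/2" S]) auto
      then show ?thesis by (auto simp: in_nhd commute)
    qed
    then have "y \<in> mtopology closure_of S" using y TM by (auto simp: metric_closure_of)
    then show "y \<in> S" using S by (simp add: closure_of_closedin)
  qed
  ultimately show ?thesis using hc by blast
qed

end

section \<open>Repairing discrete continua inside uniformly locally connected sets\<close>

context Metric_space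
begin

lemma finite_chained_connection:
  assumes "connectedin mtopology C" "a \<in> C" "b \<in> C" "e > 0"
  shows "\<exists>J. finite J \<and> J \<subseteq> C \<and> a \<in> J \<and> b \<in> J \<and> chained d e J"
  using chained_subset_finite connectedin_imp_chained[OF assms(1,4)] assms(2,3)
  unfolding chained_def by meson

text \<open>Only a small connected set joining the two points matters later, so a path is replaced
  by its image. The image is bounded, which makes the supremum in \<open>metric_diameter\<close> a
  genuine bound on the distances from \<open>a\<close>.\<close>

lemma uniformly_equi_LC0_connected:
  assumes "uniformly_equi_LC0 M d \<S>" "\<kappa> > 0" "\<Union>\<S> \<subseteq> M"
  shows "\<exists>\<delta>>0. \<forall>S\<in>\<S>. \<forall>a\<in>S. \<forall>b\<in>S. d a b < \<delta> \<longrightarrow>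
           (\<exists>C\<subseteq>S. connectedin mtopology C \<and> a \<in> C \<and> b \<in> C \<and> C \<subseteq> nhd \<kappa> {a})"
proof -
  obtain \<delta> where "\<delta> > 0" and \<delta>: "\<forall>S\<in>\<S>. \<forall>a\<in>S. \<forall>b\<in>S. d a b < \<delta> \<longrightarrow>
        (\<exists>g. pathin (subtopology mtopology S) g \<and> g 0 = a \<and> g 1 = b \<and>
             metric_diameter d (g ` {0..1}) < \<kappa>)"
    using assms(1,2) unfolding uniformly_equi_LC0_def by meson
  have "\<exists>C\<subseteq>S. connectedin mtopology C \<and> a \<in> C \<and> b \<in> C \<and> C \<subseteq> nhd \<kappa> {a}"
    if S: "S \<in> \<S>" and ab: "a \<in> S" "b \<in> S" "d a b < \<delta>" for S a b
  proof -
    obtain g where g: "pathin (subtopology mtopology S) g" "g 0 = a" "g 1 = b"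
        "metric_diameter d (g ` {0..1}) < \<kappa>"
      using \<delta> S ab by blast
    let ?C = "g ` {0..1}"
    have con: "connectedin mtopology ?C" "?C \<subseteq> S"
      using connectedin_path_image[OF g(1)] by (simp_all add: connectedin_subtopology)
    have CM: "?C \<subseteq> M" using con(2) assms(3) S by blast
    have "compactin mtopology ?C"
      using compactin_path_image[OF g(1)] by (simp add: compactin_subtopology)
    then have "mbounded ?C" by (rule compactin_imp_mbounded)
    then obtain B where B: "\<And>y z. y \<in> ?C \<Longrightarrow> z \<in> ?C \<Longrightarrow> d y z \<le> B"
      unfolding mbounded_alt by blast
    have aC: "a \<in> ?C" "b \<in> ?C" using g(2,3) by force+
    have "d a c < \<kappa>" if "c \<in> ?C" for c
    proof -
      have "d a c \<le> metric_diameter d ?C"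
        unfolding metric_diameter_def
        by (rule cSup_upper) (use that aC B in \<open>auto intro!: bdd_aboveI[of _ B]\<close>)
      then show ?thesis using g(4) by simp
    qed
    then have "?C \<subseteq> nhd \<kappa> {a}" using CM aC unfolding in_nhd subset_iff by blast
    then show ?thesis using con aC by blast
  qed
  then show ?thesis using \<open>\<delta> > 0\<close> by blast
qed

lemma compactin_finite_net:
  assumes "compactin mtopology \<theta>" "e > 0"
  obtains N where "finite N" "N \<subseteq> \<theta>" "\<theta> \<subseteq> nhd e N"
proof -
  have "mtotally_bounded \<theta>" using assms(1) by (rule compactin_imp_mtotally_bounded)
  from this[unfolded mtotally_bounded_def, rule_format, OF assms(2)]
  obtain N where "finite N" "N \<subseteq> \<theta>" "\<theta> \<subseteq> (\<Union>x\<in>N. mball x e)" by auto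
  then show thesis using that[of N] by (simp add: metric_nhd_def)
qed

text \<open>Finite chains in \<open>S\<close> from one point of a finite net of
  \<open>\<theta>\<close> to all the others form a star, which is chained through its
  centre.\<close>

lemma quasi_continuum_exists:
  assumes S: "connectedin mtopology S" and \<theta>: "compactin mtopology \<theta>" "\<theta> \<subseteq> S" "\<theta> \<noteq> {}"
    and "\<delta> > 0"
  shows "\<exists>K. quasi_continuum \<delta> S \<theta> K"
proof -
  have SM: "S \<subseteq> M" using S connectedin_subset_topspace by fastforce
  obtain N where N: "finite N" "N \<subseteq> \<theta>" "\<theta> \<subseteq> nhd \<delta> N"
    using compactin_finite_net[OF \<theta>(1) \<open>\<delta> > 0\<close>] .
  with \<theta>(3) obtain a where a: "a \<in> N" by (fastforce simp: metric_nhd_def)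
  have "\<exists>J. finite J \<and> J \<subseteq> S \<and> a \<in> J \<and> t \<in> J \<and> chained d \<delta> J" if "t \<in> N" for t
    using finite_chained_connection[OF S _ _ \<open>\<delta> > 0\<close>] a that N(2) \<theta>(2) by blast
  then obtain J where J: "\<And>t. t \<in> N \<Longrightarrow> finite (J t) \<and> J t \<subseteq> S \<and> a \<in> J t \<and> t \<in> J t \<and> chained d \<delta> (J t)"
    by metis
  let ?K = "\<Union>t\<in>N. J t"
  have "chained d \<delta> ?K"
  proof (rule chainedI_base[of _ a])
    fix z assume "z \<in> ?K"
    then obtain t where t: "t \<in> N" "z \<in> J t" by blast
    show "(a, z) \<in> (link d \<delta> ?K)\<^sup>*"
      by (rule chained_imp_rtrancl[of d \<delta> "J t"]) (use J t in auto)
  qed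
  moreover have "?K \<subseteq> S" using J by blast
  then have "?K \<subseteq> nhd \<delta> S"
    using subset_nhd_mono[OF subset_nhd_self[of ?K \<delta>], of S \<delta>] SM \<open>\<delta> > 0\<close> by blast
  moreover have "\<theta> \<subseteq> nhd \<delta> ?K"
    using subset_nhd_mono[OF N(3), of ?K \<delta>] J by blast
  ultimately have "quasi_continuum \<delta> S \<theta> ?K"
    using N(1) a J unfolding quasi_continuum_def by blast
  then show ?thesis by blast
qed

text \<open>The vertices of \<open>K\<close> are moved into \<open>S\<close> by \<open>p\<close>,
  and \<open>q\<close> attaches a fine net of \<open>\<theta>\<close> to \<open>K\<close>.
  Neighbours after the move are less than \<open>\<epsilon>\<close> apart, so small connected
  subsets of \<open>S\<close> join them, and these are replaced by finite chains of scale
  \<open>\<delta>'\<close>. The essential point is that \<open>\<delta>\<close> depends on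
  \<open>\<kappa>\<close> alone: the refined scale \<open>\<delta>'\<close> is arbitrary, so the
  step can be iterated.\<close>

lemma quasi_continuum_refine:
  assumes equi: "uniformly_equi_LC0 M d \<S>" and \<S>: "\<Union>\<S> \<subseteq> M" and "\<kappa> > 0"
  shows "\<exists>\<delta>>0. \<forall>S\<in>\<S>. \<forall>\<theta> K \<delta>'. compactin mtopology \<theta> \<and> \<theta> \<subseteq> S \<and> quasi_continuum \<delta> S \<theta> K \<and> \<delta>' > 0 \<longrightarrow>
           (\<exists>K'. quasi_continuum \<delta>' S \<theta> K' \<and> hclose \<kappa> K' K)"
proof -
  have "\<kappa>/2 > 0" using \<open>\<kappa> > 0\<close> by simp
  from uniformly_equi_LC0_connected[OF equi this \<S>]
  obtain \<epsilon> where "\<epsilon> > 0" and \<epsilon>': "\<forall>S\<in>\<S>. \<forall>a\<in>S. \<forall>b\<in>S. d a b < \<epsilon> \<longrightarrow>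
      (\<exists>C\<subseteq>S. connectedin mtopology C \<and> a \<in> C \<and> b \<in> C \<and> C \<subseteq> nhd (\<kappa>/2) {a})" by blast
  note \<epsilon> = \<epsilon>'[rule_format]
  \<comment> \<open>A link of length below \<open>\<delta>\<close> with both ends moved by less than
    \<open>\<delta>\<close> stays below \<open>3 * \<delta>\<close>. The bound
    \<open>\<kappa>/2\<close> leaves another \<open>\<kappa>/2\<close> for the size of the joining
    sets.\<close>
  define \<delta> where "\<delta> = min (\<epsilon>/3) (\<kappa>/2)"
  have "\<delta> > 0" using \<open>\<epsilon> > 0\<close> \<open>\<kappa> > 0\<close> by (simp add: \<delta>_def)
  have \<delta>\<epsilon>: "3 * \<delta> \<le> \<epsilon>" "\<delta> \<le> \<kappa>/2" by (auto simp: \<delta>_def)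
  have "\<exists>K'. quasi_continuum \<delta>' S \<theta> K' \<and> hclose \<kappa> K' K"
    if S: "S \<in> \<S>" and \<theta>: "compactin mtopology \<theta>" "\<theta> \<subseteq> S" and K: "quasi_continuum \<delta> S \<theta> K" and "\<delta>' > 0"
    for S \<theta> K \<delta>'
  proof -
    have SM: "S \<subseteq> M" using S \<S> by blast
    have KM: "K \<subseteq> M" using quasi_continuum_subset[OF K] .
    have K': "finite K" "K \<noteq> {}" "K \<subseteq> nhd \<delta> S" "\<theta> \<subseteq> nhd \<delta> K" "chained d \<delta> K"
      using K unfolding quasi_continuum_def by auto
    obtain N where N: "finite N" "N \<subseteq> \<theta>" "\<theta> \<subseteq> nhd \<delta>' N"
      using compactin_finite_net[OF \<theta>(1) \<open>\<delta>' > 0\<close>] .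
    have "\<exists>p. \<forall>k\<in>K. p k \<in> S \<and> d (p k) k < \<delta>"
      using subset_nhdD[OF K'(3)] by metis
    then obtain p where p: "\<And>k. k \<in> K \<Longrightarrow> p k \<in> S \<and> d (p k) k < \<delta>" by blast
    have "\<exists>q. \<forall>t\<in>N. q t \<in> K \<and> d (q t) t < \<delta>"
      using subset_nhdD[OF K'(4)] N(2) by (metis subsetD)
    then obtain q where q: "\<And>t. t \<in> N \<Longrightarrow> q t \<in> K \<and> d (q t) t < \<delta>" by blast
    have "\<exists>J. finite J \<and> J \<subseteq> S \<and> a \<in> J \<and> b \<in> J \<and> chained d \<delta>' J \<and> J \<subseteq> nhd (\<kappa>/2) {a}"
      if ab: "a \<in> S" "b \<in> S" "d a b < \<epsilon>" for a b
    proof -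
      obtain C where "C \<subseteq> S" "connectedin mtopology C" "a \<in> C" "b \<in> C" "C \<subseteq> nhd (\<kappa>/2) {a}"
        using \<epsilon>[OF S ab] by blast
      with finite_chained_connection[of C a b \<delta>'] \<open>\<delta>' > 0\<close> show ?thesis
        by (meson order_trans)
    qed
    then obtain J where J: "\<And>a b. a \<in> S \<Longrightarrow> b \<in> S \<Longrightarrow> d a b < \<epsilon> \<Longrightarrow>
        finite (J a b) \<and> J a b \<subseteq> S \<and> a \<in> J a b \<and> b \<in> J a b \<and> chained d \<delta>' (J a b) \<and> J a b \<subseteq> nhd (\<kappa>/2) {a}"
      by metis
    have link_p: "d (p k) (p k') < \<epsilon>" if "k \<in> K" "k' \<in> K" "d k k' < \<delta>" for k k'
    proof -
      have M: "p k \<in> M" "p k' \<in> M" "k \<in> M" "k' \<in> M" using that p SM KM by auto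
      have "d (p k) (p k') \<le> d (p k) k + (d k k' + d k' (p k'))"
        using triangle[of "p k" k "p k'"] triangle[of k k' "p k'"] M by linarith
      then show ?thesis using p[OF that(1)] p[OF that(2)] that(3) commute[of k' "p k'"] \<delta>\<epsilon> by linarith
    qed
    have link_q: "d (p (q t)) t < \<epsilon>" if "t \<in> N" for t
    proof -
      have qK: "q t \<in> K" "d (q t) t < \<delta>" using q that by auto
      have M: "p (q t) \<in> M" "q t \<in> M" "t \<in> M" using that qK p SM KM N(2) \<theta>(2) by auto
      have "d (p (q t)) t \<le> d (p (q t)) (q t) + d (q t) t"
        using triangle M by blast
      then show ?thesis using p[OF qK(1)] qK(2) \<delta>\<epsilon> \<open>\<delta> > 0\<close> by linarith
    qed
    define L where "L = (\<Union>(k, k')\<in>link d \<delta> K. J (p k) (p k')) \<union> (\<Union>t\<in>N. J (p (q t)) t)"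
    have J1: "finite (J (p k) (p k')) \<and> J (p k) (p k') \<subseteq> S \<and> p k \<in> J (p k) (p k') \<and> p k' \<in> J (p k) (p k')
        \<and> chained d \<delta>' (J (p k) (p k')) \<and> J (p k) (p k') \<subseteq> nhd (\<kappa>/2) {p k} \<and> J (p k) (p k') \<subseteq> L"
      if kk: "(k, k') \<in> link d \<delta> K" for k k'
    proof -
      have "J (p k) (p k') \<subseteq> L" using kk unfolding L_def by blast
      then show ?thesis using J[of "p k" "p k'"] p link_p[of k k'] kk unfolding link_def by blast
    qed
    have J2: "finite (J (p (q t)) t) \<and> J (p (q t)) t \<subseteq> S \<and> p (q t) \<in> J (p (q t)) t \<and> t \<in> J (p (q t)) t
        \<and> chained d \<delta>' (J (p (q t)) t) \<and> J (p (q t)) t \<subseteq> nhd (\<kappa>/2) {p (q t)} \<and> J (p (q t)) t \<subseteq> L"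
      if t: "t \<in> N" for t
    proof -
      have "J (p (q t)) t \<subseteq> L" using t unfolding L_def by blast
      moreover have "t \<in> S" using t N(2) \<theta>(2) by blast
      ultimately show ?thesis using J[of "p (q t)" t] p q[OF t] link_q[OF t] by blast
    qed
    \<comment> \<open>Self-links ensure that \<open>p k\<close> enters \<open>L\<close> even if
      \<open>K\<close> is a singleton and the net \<open>N\<close> is empty.\<close>
    have refl: "(k, k) \<in> link d \<delta> K" if "k \<in> K" for k
      using that \<open>\<delta> > 0\<close> KM by (auto simp: link_def)
    have finL: "finite L"
    proof -
      have "finite (link d \<delta> K)"
        by (rule finite_subset[of _ "K \<times> K"]) (use K'(1) in \<open>auto simp: link_def\<close>)
      then show ?thesis unfolding L_def using J1 J2 N(1) by auto
    qed
    have LS: "L \<subseteq> S" unfolding L_def using J1 J2 by blast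
    have pL: "p k \<in> L" if "k \<in> K" for k using J1[OF refl[OF that]] by blast
    have L_cases: "\<exists>k\<in>K. \<exists>A. A \<subseteq> L \<and> p k \<in> A \<and> z \<in> A \<and> chained d \<delta>' A \<and> A \<subseteq> nhd (\<kappa>/2) {p k}"
      if "z \<in> L" for z
    proof -
      from that consider k k' where "(k, k') \<in> link d \<delta> K" "z \<in> J (p k) (p k')"
        | t where "t \<in> N" "z \<in> J (p (q t)) t" unfolding L_def by blast
      then show ?thesis
      proof cases
        case 1
        then have "k \<in> K" by (simp add: link_def)
        with J1[OF 1(1)] 1(2) show ?thesis by blast
      next
        case 2
        then show ?thesis using J2[OF 2(1)] q[OF 2(1)] by blast
      qed
    qed
    obtain k0 where k0: "k0 \<in> K" using K'(2) by blast
    have reach: "(p k0, p k) \<in> (link d \<delta>' L)\<^sup>*" if "k \<in> K" for k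
    proof -
      have "(k0, k) \<in> (link d \<delta> K)\<^sup>*" using K'(5) k0 that by (simp add: chained_def)
      then show ?thesis
      proof (induction rule: rtrancl_induct)
        case (step y z)
        have "(p y, p z) \<in> (link d \<delta>' L)\<^sup>*"
          using J1[OF step(2)] chained_imp_rtrancl[of d \<delta>' "J (p y) (p z)" "p y" "p z" L \<delta>'] by blast
        with step.IH show ?case by (rule rtrancl_trans)
      qed auto
    qed
    have "chained d \<delta>' L"
    proof (rule chainedI_base[of _ "p k0"])
      fix z assume "z \<in> L"
      then obtain k A where k: "k \<in> K" "A \<subseteq> L" "p k \<in> A" "z \<in> A" "chained d \<delta>' A"
        using L_cases by blast
      have "(p k, z) \<in> (link d \<delta>' L)\<^sup>*"
        using chained_imp_rtrancl[OF k(5,3,4,2) order.refl] .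
      with reach[OF k(1)] show "(p k0, z) \<in> (link d \<delta>' L)\<^sup>*" by (rule rtrancl_trans)
    qed
    moreover have "L \<subseteq> nhd \<delta>' S"
      using subset_nhd_mono[OF subset_nhd_self[of L \<delta>'] LS order.refl] LS SM \<open>\<delta>' > 0\<close> by blast
    moreover have "N \<subseteq> L" using J2 by blast
    then have "\<theta> \<subseteq> nhd \<delta>' L" using subset_nhd_mono[OF N(3) _ order.refl] by blast
    ultimately have "quasi_continuum \<delta>' S \<theta> L"
      using finL pL[OF k0] unfolding quasi_continuum_def by blast
    moreover have "L \<subseteq> nhd \<kappa> K"
    proof
      fix z assume z: "z \<in> L"
      then obtain k where k: "k \<in> K" "z \<in> nhd (\<kappa>/2) {p k}" using L_cases by blast
      have "{p k} \<subseteq> nhd (\<kappa>/2) K"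
        using p[OF k(1)] k(1) KM SM \<delta>\<epsilon>(2) commute[of k "p k"] by (force simp: in_nhd)
      with metric_nhd_trans[of "{z}" "\<kappa>/2" "{p k}" "\<kappa>/2" K] k(2)
      show "z \<in> nhd \<kappa> K" by simp
    qed
    moreover have "K \<subseteq> nhd \<kappa> L"
    proof
      fix k assume k: "k \<in> K"
      then show "k \<in> nhd \<kappa> L"
        using p[OF k] pL[OF k] KM SM \<delta>\<epsilon>(2) \<open>\<kappa> > 0\<close> unfolding in_nhd
        by (intro bexI[of _ "p k"]) auto
    qed
    ultimately show ?thesis unfolding hclose_def by blast
  qed
  with \<open>\<delta> > 0\<close> show ?thesis by blast
qed

text \<open>Refinement is iterated with errors \<open>c / 2^n\<close> and the limit is taken. Only
  the initial scale \<open>\<delta> 0\<close> has to be met by the given set.\<close>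

lemma continuum_near_quasi_continuum:
  assumes "mcomplete" and equi: "uniformly_equi_LC0 M d \<S>"
    and \<S>: "\<And>S. S \<in> \<S> \<Longrightarrow> closedin mtopology S" and "\<kappa> > 0"
  shows "\<exists>\<delta>>0. \<forall>S\<in>\<S>. \<forall>\<theta> K. compactin mtopology \<theta> \<and> \<theta> \<subseteq> S \<and> quasi_continuum \<delta> S \<theta> K \<longrightarrow>
           (\<exists>T\<in>compact_connected_sets mtopology. \<theta> \<subseteq> T \<and> T \<subseteq> S \<and> hclose \<kappa> T K)"
proof -
  have SM: "\<Union>\<S> \<subseteq> M" using \<S> closedin_subset by fastforce
  obtain D where D: "\<And>\<kappa>. \<kappa> > 0 \<Longrightarrow> D \<kappa> > 0"
    and ref: "\<And>\<kappa> S \<theta> K \<delta>'. \<kappa> > 0 \<Longrightarrow> S \<in> \<S> \<Longrightarrow> compactin mtopology \<theta> \<Longrightarrow> \<theta> \<subseteq> S \<Longrightarrow>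
      quasi_continuum (D \<kappa>) S \<theta> K \<Longrightarrow> \<delta>' > 0 \<Longrightarrow> \<exists>K'. quasi_continuum \<delta>' S \<theta> K' \<and> hclose \<kappa> K' K"
    using quasi_continuum_refine[OF equi SM] by metis
  \<comment> \<open>The quarter cancels the factor 4 in the error of the limit at
    \<open>n = 0\<close>.\<close>
  define c where "c = \<kappa>/4"
  have c: "c > 0" using \<open>\<kappa> > 0\<close> by (simp add: c_def)
  \<comment> \<open>The first bound permits the next refinement, the second drives the scale to
    0.\<close>
  define \<delta> where "\<delta> n = min (D (c/2^n)) (1/2^n)" for n :: nat
  have \<delta>_pos: "\<delta> n > 0" for n using D[of "c/2^n"] c by (simp add: \<delta>_def)
  have lim: "\<delta> \<longlonglongrightarrow> 0"
  proof (rule tendsto_sandwich[OF _ _ tendsto_const])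
    show "(\<lambda>n. 1/2^n :: real) \<longlonglongrightarrow> 0" by (rule LIMSEQ_divide_realpow_zero) simp
    show "\<forall>\<^sub>F n in sequentially. 0 \<le> \<delta> n" using \<delta>_pos less_imp_le by (intro always_eventually allI) blast
    show "\<forall>\<^sub>F n in sequentially. \<delta> n \<le> 1/2^n" by (simp add: \<delta>_def)
  qed
  have "\<exists>T\<in>compact_connected_sets mtopology. \<theta> \<subseteq> T \<and> T \<subseteq> S \<and> hclose \<kappa> T K0"
    if S: "S \<in> \<S>" and \<theta>: "compactin mtopology \<theta>" "\<theta> \<subseteq> S" and K0: "quasi_continuum (\<delta> 0) S \<theta> K0" for S \<theta> K0
  proof -
    \<comment> \<open>The clause for \<open>n = 0\<close> pins the start of the dependent choice to
      the given set.\<close>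
    have "\<exists>K. \<forall>n. (quasi_continuum (\<delta> n) S \<theta> (K n) \<and> (n = 0 \<longrightarrow> K n = K0)) \<and> hclose (c/2^n) (K n) (K (Suc n))"
    proof (rule dependent_nat_choice)
      show "\<exists>K. quasi_continuum (\<delta> 0) S \<theta> K \<and> (0 = (0::nat) \<longrightarrow> K = K0)" using K0 by blast
      fix K n assume "quasi_continuum (\<delta> n) S \<theta> K \<and> (n = 0 \<longrightarrow> K = K0)"
      then have "quasi_continuum (D (c/2^n)) S \<theta> K" by (elim conjE quasi_continuum_mono) (simp add: \<delta>_def)
      moreover have "c/2^n > 0" using c by simp
      ultimately obtain K' where "quasi_continuum (\<delta> (Suc n)) S \<theta> K'" "hclose (c/2^n) K' K"
        using ref[of "c/2^n" S \<theta> K "\<delta> (Suc n)"] S \<theta> \<delta>_pos by blast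
      then show "\<exists>K'. (quasi_continuum (\<delta> (Suc n)) S \<theta> K' \<and> (Suc n = 0 \<longrightarrow> K' = K0)) \<and> hclose (c/2^n) K K'"
        using hclose_sym by blast
    qed
    then obtain K where K: "\<And>n. quasi_continuum (\<delta> n) S \<theta> (K n)" "K 0 = K0"
        "\<And>n. hclose (c/2^n) (K n) (K (Suc n))" by blast
    obtain T where "T \<in> compact_connected_sets mtopology" "\<theta> \<subseteq> T" "T \<subseteq> S"
        and T: "\<And>n. hclose (4 * c / 2^n) T (K n)"
      using quasi_continua_limit[OF assms(1) \<S>[OF S] K(1) lim K(3) c] by blast
    moreover have "hclose \<kappa> T K0" using T[of 0] K(2) by (simp add: c_def)
    ultimately show ?thesis by blast
  qed
  then show ?thesis using \<delta>_pos[of 0] by blast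
qed

end

section \<open>Points reached by cheap walks\<close>

text \<open>Nodes are pairs because a point may belong to several nets, and the price of visiting it
  depends on the net. A step may change the net whenever the two points are close.\<close>

definition walk :: "('a \<Rightarrow> 'a \<Rightarrow> real) \<Rightarrow> real \<Rightarrow> 'v set \<Rightarrow> ('v \<Rightarrow> 'a set) \<Rightarrow> ('v \<times> 'a) list \<Rightarrow> bool" where
  "walk d e \<tau> R p \<longleftrightarrow> p \<noteq> [] \<and> set p \<subseteq> Sigma \<tau> R \<and> successively (\<lambda>u v. d (snd u) (snd v) < e) p"

text \<open>Nodes are charged rather than links, so deleting the last node of a walk saves exactly
  the price of its net.\<close>

definition cost :: "('v \<Rightarrow> real) \<Rightarrow> ('v \<times> 'a) list \<Rightarrow> real" where
  "cost w p = (\<Sum>u\<leftarrow>p. w (fst u))"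

definition reached :: "('a \<Rightarrow> 'a \<Rightarrow> real) \<Rightarrow> real \<Rightarrow> 'v set \<Rightarrow> ('v \<Rightarrow> 'a set) \<Rightarrow> ('v \<Rightarrow> real) \<Rightarrow> 'a set" where
  "reached d e \<tau> R w = {snd (last p) | p. walk d e \<tau> R p \<and> w (fst (hd p)) = 0 \<and> cost w p \<le> 1}"

lemma cost_append [simp]: "cost w (p @ q) = cost w p + cost w q"
  by (simp add: cost_def)

lemma cost_Cons [simp]: "cost w (u # p) = w (fst u) + cost w p"
  by (simp add: cost_def)

lemma cost_Nil [simp]: "cost w [] = 0"
  by (simp add: cost_def)

lemma cost_nonneg: "(\<And>u. u \<in> set p \<Longrightarrow> 0 \<le> w (fst u)) \<Longrightarrow> 0 \<le> cost w p"
  unfolding cost_def by (intro sum_list_nonneg) auto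

lemma weight_le_cost:
  assumes "\<And>u. u \<in> set p \<Longrightarrow> 0 \<le> w (fst u)" "u \<in> set p"
  shows "w (fst u) \<le> cost w p"
proof -
  obtain xs ys where p: "p = xs @ u # ys" using assms(2) by (auto simp: in_set_conv_decomp)
  have "0 \<le> cost w xs" "0 \<le> cost w ys" using assms(1) p by (auto intro!: cost_nonneg)
  then show ?thesis using p by simp
qed

lemma walk_append:
  assumes "walk d e \<tau> R p" "walk d e \<tau> R q" "d (snd (last p)) (snd (hd q)) < e"
  shows "walk d e \<tau> R (p @ q)"
  using assms unfolding walk_def by (auto simp: successively_append_iff)

lemma walk_mono: "walk d e \<tau> R p \<Longrightarrow> \<tau> \<subseteq> \<tau>' \<Longrightarrow> walk d e \<tau>' R p"
  unfolding walk_def by blast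

text \<open>Between two visits to the same node the loop can be cut out at no extra cost. Afterwards
  the length is bounded by the number of available nodes, which turns a bound on the change of
  prices into a bound on the change of cost.\<close>

lemma walk_distinct:
  assumes "walk d e \<tau> R p" "\<And>V. V \<in> \<tau> \<Longrightarrow> 0 \<le> w V"
  shows "\<exists>q. walk d e \<tau> R q \<and> hd q = hd p \<and> last q = last p \<and> distinct q \<and> cost w q \<le> cost w p"
  using assms(1)
proof (induction "length p" arbitrary: p rule: less_induct)
  case less
  show ?case
  proof (cases "distinct p")
    case True
    then show ?thesis using less.prems by blast
  next
    case False
    then obtain xs ys zs y where p: "p = xs @ [y] @ ys @ [y] @ zs"
      using not_distinct_decomp by blast
    let ?q = "xs @ [y] @ zs"
    have q: "walk d e \<tau> R ?q"
      using less.prems unfolding p walk_def by (auto simp: successively_append_iff successively_Cons)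
    have "\<exists>q. walk d e \<tau> R q \<and> hd q = hd ?q \<and> last q = last ?q \<and> distinct q \<and> cost w q \<le> cost w ?q"
      using less.hyps[OF _ q] p by simp
    moreover have "hd ?q = hd p" "last ?q = last p" by (simp_all add: p hd_append)
    moreover have "0 \<le> cost w ys" "0 \<le> w (fst y)"
      using less.prems assms(2) unfolding p walk_def by (force intro!: cost_nonneg)+
    then have "cost w ?q \<le> cost w p" by (simp add: p)
    ultimately show ?thesis by (metis order_trans)
  qed
qed

lemma chained_imp_walk:
  assumes "chained d e (R V)" "a \<in> R V" "b \<in> R V"
  shows "\<exists>p. walk d e {V} R p \<and> hd p = (V, a) \<and> last p = (V, b)"
proof -
  have "(a, b) \<in> (link d e (R V))\<^sup>*" using assms by (simp add: chained_def)
  then show ?thesis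
  proof (induction rule: rtrancl_induct)
    case base
    then show ?case using assms(2) by (intro exI[of _ "[(V, a)]"]) (simp add: walk_def)
  next
    case (step y z)
    then obtain p where p: "walk d e {V} R p" "hd p = (V, a)" "last p = (V, y)" by blast
    have "walk d e {V} R [(V, z)]" "d y z < e" using step(2) by (auto simp: walk_def link_def)
    then have "walk d e {V} R (p @ [(V, z)])" using p by (intro walk_append) auto
    moreover have "hd (p @ [(V, z)]) = (V, a)" using p by (simp add: walk_def)
    ultimately show ?case by (intro exI[of _ "p @ [(V, z)]"]) auto
  qed
qed

lemma chained_imp_cheap_walk:
  assumes "chained d e (R V)" "a \<in> R V" "b \<in> R V" "finite (R V)" "0 \<le> w V"
  shows "\<exists>p. walk d e {V} R p \<and> hd p = (V, a) \<and> last p = (V, b) \<and> cost w p \<le> real (card (R V)) * w V"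
proof -
  obtain p where p: "walk d e {V} R p" "hd p = (V, a)" "last p = (V, b)"
    using chained_imp_walk[of d e R V, OF assms(1-3)] by blast
  \<comment> \<open>Weight zero is inserted because only the length of the walk matters here; its
    price follows from the length.\<close>
  obtain q where q: "walk d e {V} R q" "hd q = (V, a)" "last q = (V, b)" "distinct q"
    using walk_distinct[OF p(1), of "\<lambda>_. 0"] p by auto
  have "length q = card (set q)" using q(4) by (simp add: distinct_card)
  also have "\<dots> \<le> card (Sigma {V} R)"
    using q(1) assms(4) by (intro card_mono) (auto simp: walk_def)
  also have "\<dots> = card (R V)" using assms(4) by simp
  finally have len: "length q \<le> card (R V)" .
  have "map (\<lambda>u. w (fst u)) q = map (\<lambda>u. w V) q" using q(1) by (auto simp: walk_def)
  then have "cost w q = length q * w V" by (simp only: cost_def sum_list_triv)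
  also have "\<dots> \<le> card (R V) * w V" using len assms(5) by (intro mult_right_mono) auto
  finally show ?thesis using q by blast
qed

text \<open>The weights \<open>w\<close>, \<open>w'\<close> differ so little that a cheap walk for \<open>w\<close>, prolonged at its start to reach a
  node of \<open>w'\<close>-weight zero, becomes cheap for \<open>w'\<close> after its last node is deleted. This can only fail when
  the last set visited is cheap to traverse entirely, and then all of it is reached.\<close>

lemma reached_perturb:
  fixes d :: "'a \<Rightarrow> 'a \<Rightarrow> real" and w w' :: "'v \<Rightarrow> real" and \<eta> :: real and N :: nat
  assumes sub: "\<sigma> \<subseteq> \<tau>" and fin: "finite \<tau>" "\<And>V. V \<in> \<tau> \<Longrightarrow> finite (R V)"
    and chained: "\<And>V. V \<in> \<tau> \<Longrightarrow> chained d e (R V)"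
    and touch: "\<And>V V'. V \<in> \<tau> \<Longrightarrow> V' \<in> \<tau> \<Longrightarrow> \<exists>a\<in>R V. \<exists>b\<in>R V'. d a b < e"
    and d0: "\<And>V a. V \<in> \<tau> \<Longrightarrow> a \<in> R V \<Longrightarrow> d a a < e"
    and w: "\<And>V. V \<in> \<sigma> \<Longrightarrow> 0 \<le> w V" and w': "\<And>V. V \<in> \<tau> \<Longrightarrow> 0 \<le> w' V"
    and diff: "\<And>V. V \<in> \<sigma> \<Longrightarrow> w' V \<le> w V + \<eta>" and \<eta>: "0 \<le> \<eta>" "2 * N * N * \<eta> \<le> 1"
    and N: "(\<Sum>V\<in>\<sigma>. card (R V)) \<le> N"
    and U: "U \<in> \<tau>" "w' U = 0"
    and z: "z \<in> reached d e \<sigma> R w"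
  shows "\<exists>z'\<in>reached d e \<tau> R w'. d z' z < e"
proof -
  have finR: "finite (R V)" and card_le: "card (R V) \<le> N" if "V \<in> \<sigma>" for V
  proof -
    show "finite (R V)" using that sub fin by blast
    have "finite \<sigma>" using sub fin(1) finite_subset by blast
    then have "card (R V) \<le> (\<Sum>V\<in>\<sigma>. card (R V))"
      using that by (intro member_le_sum) auto
    then show "card (R V) \<le> N" using N by linarith
  qed
  obtain p0 where p0: "walk d e \<sigma> R p0" "w (fst (hd p0)) = 0" "cost w p0 \<le> 1" "z = snd (last p0)"
    using z by (auto simp: reached_def)
  obtain p where p: "walk d e \<sigma> R p" "hd p = hd p0" "last p = last p0" "distinct p" "cost w p \<le> 1"
    using walk_distinct[of d e \<sigma> R p0 w] p0 w by force
  have p_nodes: "fst u \<in> \<sigma>" "snd u \<in> R (fst u)" if "u \<in> set p" for u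
    using that p(1) by (auto simp: walk_def)
  have pne: "p \<noteq> []" using p(1) by (simp add: walk_def)
  have N_pos: "N \<ge> 1"
  proof -
    have "snd (hd p) \<in> R (fst (hd p))" "fst (hd p) \<in> \<sigma>" using p_nodes pne by auto
    then have "card (R (fst (hd p))) \<ge> 1" using finR by (metis One_nat_def Suc_leI card_gt_0_iff empty_iff)
    then show ?thesis using card_le \<open>fst (hd p) \<in> \<sigma>\<close> order_trans by blast
  qed
  have len_p: "length p \<le> N"
  proof -
    have fs: "finite \<sigma>" using sub fin(1) finite_subset by blast
    have "length p = card (set p)" using p(4) by (simp add: distinct_card)
    also have "\<dots> \<le> card (Sigma \<sigma> R)"
      using p(1) fs finR by (intro card_mono) (auto simp: walk_def)
    also have "\<dots> = (\<Sum>V\<in>\<sigma>. card (R V))" using fs finR by (intro card_SigmaI) auto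
    finally show ?thesis using N by linarith
  qed
  have "cost w' q \<le> cost w q + length q * \<eta>" if "set q \<subseteq> set p" for q
    using that
  proof (induction q)
    case (Cons u q)
    have "w' (fst u) \<le> w (fst u) + \<eta>" using Cons p_nodes by (intro diff) auto
    with Cons show ?case by (simp add: algebra_simps)
  qed simp
  then have "cost w' p \<le> cost w p + length p * \<eta>" by blast
  also have "\<dots> \<le> 1 + N * \<eta>"
    using p(5) len_p \<eta>(1) by (intro add_mono mult_right_mono) auto
  finally have cost_p: "cost w' p \<le> 1 + N * \<eta>" .
  \<comment> \<open>The old starting net \<open>V0\<close> was free for \<open>w\<close> but may
    cost up to \<open>\<eta>\<close> per node for \<open>w'\<close>. The walk is therefore begun in
    \<open>U\<close>, and crossing the net of \<open>V0\<close> to the old starting point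
    \<open>s0\<close> costs at most \<open>N * \<eta>\<close>.\<close>
  obtain V0 s0 where h: "hd p = (V0, s0)" by (cases "hd p") auto
  have V0: "V0 \<in> \<sigma>" "s0 \<in> R V0" "w V0 = 0" using p_nodes[OF hd_in_set[OF pne]] h p(2) p0(2) by auto
  then have V0': "V0 \<in> \<tau>" "w' V0 \<le> \<eta>" using sub diff[of V0] by auto
  obtain u v where uv: "u \<in> R U" "v \<in> R V0" "d u v < e" using touch[OF U(1) V0'(1)] by blast
  obtain r where r: "walk d e {V0} R r" "hd r = (V0, v)" "last r = (V0, s0)" "cost w' r \<le> card (R V0) * w' V0"
    using chained_imp_cheap_walk[of d e R V0 v s0 w', OF chained[OF V0'(1)] uv(2) V0(2) finR[OF V0(1)] w'[OF V0'(1)]] by blast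
  have rne: "r \<noteq> []" using r(1) by (simp add: walk_def)
  have "card (R V0) * w' V0 \<le> N * \<eta>"
    using card_le[OF V0(1)] V0'(2) w'[OF V0'(1)] by (intro mult_mono) auto
  then have cost_r: "cost w' r \<le> N * \<eta>" using r(4) by linarith
  have walk_u: "walk d e \<tau> R [(U, u)]" using uv U by (simp add: walk_def)
  have walk_rp: "walk d e \<tau> R (r @ p)"
    using walk_mono[OF r(1), of \<tau>] walk_mono[OF p(1) sub] r(3) h d0[OF V0'(1) V0(2)] V0'(1)
    by (intro walk_append) auto
  have walk_t: "walk d e \<tau> R ([(U, u)] @ (r @ p))"
    by (rule walk_append[OF walk_u walk_rp]) (use uv(3) r(2) rne in simp)
  \<comment> \<open>The prolonged walk exceeds the budget by at most \<open>2 * N * \<eta>\<close>,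
    half from the new prices and half from the prolongation. Dropping the last node is meant to save
    this amount.\<close>
  define t where "t = (U, u) # r @ butlast p"
  have pl: "p = butlast p @ [last p]" using pne by simp
  obtain Vm where Vm: "last p = (Vm, z)" using p(3) p0(4) by (metis prod.collapse)
  have Vm_in: "Vm \<in> \<sigma>" "z \<in> R Vm" using p_nodes[OF last_in_set[OF pne]] Vm by auto
  then have Vm_\<tau>: "Vm \<in> \<tau>" using sub by blast
  show ?thesis
  proof (cases "card (R Vm) * w' Vm \<le> 1")
    case True
    \<comment> \<open>The whole net of \<open>Vm\<close> is affordable, so it is entered directly
      from \<open>U\<close> and \<open>z\<close> itself is reached; the old walk is
      discarded.\<close>
    obtain a b where ab: "a \<in> R U" "b \<in> R Vm" "d a b < e" using touch[OF U(1) Vm_\<tau>] by blast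
    obtain q where q: "walk d e {Vm} R q" "hd q = (Vm, b)" "last q = (Vm, z)" "cost w' q \<le> card (R Vm) * w' Vm"
      using chained_imp_cheap_walk[of d e R Vm b z w', OF chained[OF Vm_\<tau>] ab(2) Vm_in(2) finR[OF Vm_in(1)] w'[OF Vm_\<tau>]] by blast
    have qne: "q \<noteq> []" using q(1) by (simp add: walk_def)
    have "walk d e \<tau> R [(U, a)]" using ab U by (simp add: walk_def)
    then have "walk d e \<tau> R ([(U, a)] @ q)"
      using walk_mono[OF q(1), of \<tau>] Vm_\<tau> q(2) ab(3) by (intro walk_append) auto
    moreover have "cost w' ([(U, a)] @ q) \<le> 1" using q(4) True U(2) by simp
    moreover have "snd (last ([(U, a)] @ q)) = z" "w' (fst (hd ([(U, a)] @ q))) = 0" using q(3) qne U(2) by auto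
    ultimately have "z \<in> reached d e \<tau> R w'" unfolding reached_def by blast
    then show ?thesis using d0[OF Vm_\<tau> Vm_in(2)] by blast
  next
    case False
    \<comment> \<open>Traversing at most \<open>N\<close> nodes of \<open>Vm\<close> costs more than
      1, which is at least \<open>2 * N * N * \<eta>\<close>; hence one node costs at least
      \<open>2 * N * \<eta>\<close>, just the excess to be saved.\<close>
    have "1 < real (card (R Vm)) * w' Vm" using False by simp
    also have "\<dots> \<le> N * w' Vm" using card_le[OF Vm_in(1)] w'[OF Vm_\<tau>] by (intro mult_right_mono) auto
    finally have "N * (2 * N * \<eta>) \<le> N * w' Vm" using \<eta>(2) by (simp add: mult.assoc mult.left_commute)
    then have big: "2 * N * \<eta> \<le> w' Vm" using N_pos by simp
    have "cost w' p = cost w' (butlast p) + w' Vm" using Vm by (subst pl) simp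
    then have cost_t: "cost w' t \<le> 1"
      using cost_p cost_r big U(2) by (simp add: t_def)
    have "[(U, u)] @ (r @ p) = t @ [last p]" using pl by (simp add: t_def)
    then have "walk d e \<tau> R (t @ [last p])" using walk_t by simp
    moreover have "t \<noteq> []" by (simp add: t_def)
    ultimately have "walk d e \<tau> R t" "d (snd (last t)) z < e"
      using Vm by (auto simp: walk_def successively_append_iff)
    moreover have "w' (fst (hd t)) = 0" using U(2) by (simp add: t_def)
    ultimately have "snd (last t) \<in> reached d e \<tau> R w'" using cost_t unfolding reached_def by blast
    then show ?thesis using \<open>d (snd (last t)) z < e\<close> by blast
  qed
qed

lemma reached_subset: "reached d e \<tau> R w \<subseteq> (\<Union>V\<in>\<tau>. R V)"
  unfolding reached_def walk_def using last_in_set by fastforce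

lemma subset_reached:
  assumes "U \<in> \<tau>" "w U = 0"
  shows "R U \<subseteq> reached d e \<tau> R w"
proof
  fix u assume "u \<in> R U"
  then have "walk d e \<tau> R [(U, u)]" "cost w [(U, u)] \<le> 1" using assms by (auto simp: walk_def)
  then show "u \<in> reached d e \<tau> R w"
    unfolding reached_def using assms(2) by (intro CollectI exI[of _ "[(U, u)]"]) auto
qed

section \<open>Locally finite cozero covers\<close>

definition cozero_cover :: "'a topology \<Rightarrow> 'a set set \<Rightarrow> bool" where
  "cozero_cover X \<V> \<longleftrightarrow> locally_finite_in X \<V> \<and> \<Union>\<V> = topspace X \<and> (\<forall>V\<in>\<V>. cozero_in X V)"

lemma locally_finite_in_imp_point_finite:
  assumes "locally_finite_in X \<V>" "x \<in> topspace X"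
  shows "finite {V \<in> \<V>. x \<in> V}"
proof -
  obtain O' where "x \<in> O'" "finite {V \<in> \<V>. V \<inter> O' \<noteq> {}}"
    using assms unfolding locally_finite_in_def by blast
  then show ?thesis by (elim finite_subset[rotated]) auto
qed

lemma continuous_mapI_locally:
  assumes "\<And>x. x \<in> topspace X \<Longrightarrow>
    \<exists>O' h. openin X O' \<and> x \<in> O' \<and> continuous_map X Y h \<and> (\<forall>y\<in>O'. f y = h y)"
  shows "continuous_map X Y f"
  unfolding continuous_map
proof (intro conjI allI impI)
  show "f ` topspace X \<subseteq> topspace Y"
  proof (intro image_subsetI)
    fix x assume x: "x \<in> topspace X"
    then obtain O' h where "x \<in> O'" "continuous_map X Y h" "\<forall>y\<in>O'. f y = h y"
      using assms by metis
    with x show "f x \<in> topspace Y" by (auto simp: continuous_map)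
  qed
  fix U assume U: "openin Y U"
  show "openin X {x \<in> topspace X. f x \<in> U}"
    unfolding openin_subopen[of X "{x \<in> topspace X. f x \<in> U}"]
  proof (intro ballI)
    fix x assume "x \<in> {x \<in> topspace X. f x \<in> U}"
    then have x: "x \<in> topspace X" "f x \<in> U" by auto
    then obtain O' h where O': "openin X O'" "x \<in> O'" "continuous_map X Y h" "\<forall>y\<in>O'. f y = h y"
      using assms by metis
    have "openin X (O' \<inter> {y \<in> topspace X. h y \<in> U})"
      using O'(1,3) U by (intro openin_Int) (auto simp: continuous_map)
    moreover have "x \<in> O' \<inter> {y \<in> topspace X. h y \<in> U}" using x O'(2,4) by auto
    moreover have "O' \<inter> {y \<in> topspace X. h y \<in> U} \<subseteq> {x \<in> topspace X. f x \<in> U}"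
      using O'(4) by auto
    ultimately show "\<exists>T. openin X T \<and> x \<in> T \<and> T \<subseteq> {x \<in> topspace X. f x \<in> U}" by blast
  qed
qed

section \<open>Maxima over locally finite families\<close>

lemma continuous_map_Max_insert:
  assumes "finite A" "\<And>a. a \<in> A \<Longrightarrow> continuous_map X euclideanreal (f a)"
  shows "continuous_map X euclideanreal (\<lambda>x. Max (insert 0 ((\<lambda>a. f a x) ` A)))"
  using assms
proof (induction A rule: finite_induct)
  case (insert a A)
  have "Max (insert 0 ((\<lambda>b. f b x) ` insert a A)) = max (f a x) (Max (insert 0 ((\<lambda>b. f b x) ` A)))" for x
  proof -
    have "insert 0 ((\<lambda>b. f b x) ` insert a A) = insert (f a x) (insert 0 ((\<lambda>b. f b x) ` A))" by auto
    then show ?thesis using insert(1) by (simp only:) (rule Max_insert, auto)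
  qed
  then show ?case using insert by (simp only:) (intro continuous_map_real_max, auto)
qed simp

text \<open>The inserted 0 keeps \<open>Max\<close> meaningful where no member contains
  \<open>x\<close>, and lets the index set be enlarged by functions vanishing at \<open>x\<close>
  without changing the value.\<close>

definition locmax :: "'a set set \<Rightarrow> ('a set \<Rightarrow> 'a \<Rightarrow> real) \<Rightarrow> 'a \<Rightarrow> real" where
  "locmax \<V> f x = Max (insert 0 ((\<lambda>V. f V x) ` {V \<in> \<V>. x \<in> V}))"

lemma locmax_less_iff:
  assumes "locally_finite_in X \<V>" "x \<in> topspace X"
  shows "locmax \<V> f x < c \<longleftrightarrow> 0 < c \<and> (\<forall>V\<in>\<V>. x \<in> V \<longrightarrow> f V x < c)"
  using locally_finite_in_imp_point_finite[OF assms] unfolding locmax_def by auto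

text \<open>On a neighbourhood meeting finitely many members, the index set varying with the point
  can be replaced by the fixed finite set of these members.\<close>

lemma continuous_map_locmax:
  assumes lf: "locally_finite_in X \<V>"
    and cont: "\<And>V. V \<in> \<V> \<Longrightarrow> continuous_map X euclideanreal (f V)"
    and supp: "\<And>V x. V \<in> \<V> \<Longrightarrow> x \<in> topspace X \<Longrightarrow> x \<notin> V \<Longrightarrow> f V x = 0"
  shows "continuous_map X euclideanreal (locmax \<V> f)"
proof (rule continuous_mapI_locally)
  fix x assume "x \<in> topspace X"
  then obtain O' where O': "openin X O'" "x \<in> O'" "finite {V \<in> \<V>. V \<inter> O' \<noteq> {}}"
    using lf unfolding locally_finite_in_def by blast
  let ?A = "{V \<in> \<V>. V \<inter> O' \<noteq> {}}"
  have "locmax \<V> f y = Max (insert 0 ((\<lambda>V. f V y) ` ?A))" if y: "y \<in> O'" for y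
  proof -
    have yX: "y \<in> topspace X" using y O'(1) openin_subset by blast
    have "insert 0 ((\<lambda>V. f V y) ` {V \<in> \<V>. y \<in> V}) = insert 0 ((\<lambda>V. f V y) ` ?A)"
    proof
      show "insert 0 ((\<lambda>V. f V y) ` ?A) \<subseteq> insert 0 ((\<lambda>V. f V y) ` {V \<in> \<V>. y \<in> V})"
      proof
        fix r assume "r \<in> insert 0 ((\<lambda>V. f V y) ` ?A)"
        then consider "r = 0" | V where "V \<in> \<V>" "r = f V y" by auto
        then show "r \<in> insert 0 ((\<lambda>V. f V y) ` {V \<in> \<V>. y \<in> V})"
          using supp[OF _ yX] by cases auto
      qed
    qed (use y in auto)
    then show ?thesis by (simp add: locmax_def)
  qed
  moreover have "continuous_map X euclideanreal (\<lambda>y. Max (insert 0 ((\<lambda>V. f V y) ` ?A)))"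
    using O'(3) cont by (intro continuous_map_Max_insert) auto
  ultimately show "\<exists>O' h. openin X O' \<and> x \<in> O' \<and> continuous_map X euclideanreal h \<and> (\<forall>y\<in>O'. locmax \<V> f y = h y)"
    using O'(1,2) by blast
qed

text \<open>In contrast to a partition of unity, the normalisation is by the maximum and not by the
  sum: at every point some function equals 1, which will supply a net of price zero.\<close>

definition peaked_functions :: "'a topology \<Rightarrow> 'a set set \<Rightarrow> ('a set \<Rightarrow> 'a \<Rightarrow> real) \<Rightarrow> bool" where
  "peaked_functions X \<V> \<mu> \<longleftrightarrow>
     (\<forall>V\<in>\<V>. continuous_map X euclideanreal (\<mu> V) \<and>
        (\<forall>x\<in>topspace X. 0 \<le> \<mu> V x \<and> \<mu> V x \<le> 1 \<and> (0 < \<mu> V x \<longleftrightarrow> x \<in> V))) \<and>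
     (\<forall>x\<in>topspace X. \<exists>V\<in>\<V>. \<mu> V x = 1)"

lemma peaked_functions_exist:
  assumes "cozero_cover X \<V>"
  shows "\<exists>\<mu>. peaked_functions X \<V> \<mu>"
proof -
  have lf: "locally_finite_in X \<V>" and cover: "\<Union>\<V> = topspace X"
    and coz: "\<forall>V\<in>\<V>. \<exists>g. continuous_map X euclideanreal g \<and> V = {x \<in> topspace X. g x \<noteq> 0}"
    using assms unfolding cozero_cover_def cozero_in_def by auto
  obtain g where g: "\<And>V. V \<in> \<V> \<Longrightarrow> continuous_map X euclideanreal (g V) \<and> V = {x \<in> topspace X. g V x \<noteq> 0}"
    using bchoice[OF coz] by blast
  have gV: "x \<in> V \<longleftrightarrow> g V x \<noteq> 0" if "V \<in> \<V>" "x \<in> topspace X" for V x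
    using g[OF that(1)] that(2) by blast
  define h where "h V x = \<bar>g V x\<bar>" for V x
  define m where "m = locmax \<V> h"
  have h_cont: "continuous_map X euclideanreal (h V)" if "V \<in> \<V>" for V
    unfolding h_def using g[OF that] by (intro continuous_map_real_abs) auto
  have m_cont: "continuous_map X euclideanreal m"
    unfolding m_def
    by (rule continuous_map_locmax[OF lf]) (use h_cont gV in \<open>auto simp: h_def\<close>)
  have h_pos: "0 < h V x \<longleftrightarrow> x \<in> V" if "V \<in> \<V>" "x \<in> topspace X" for V x
    using gV[OF that] by (simp add: h_def)
  have m_pos: "0 < m x" if x: "x \<in> topspace X" for x
  proof -
    obtain V where V: "V \<in> \<V>" "x \<in> V" using x cover by blast
    have "\<not> m x < h V x" 
      unfolding m_def locmax_less_iff[OF lf x] using V by auto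
    then show ?thesis using h_pos[OF V(1) x] V(2) by auto
  qed
  have h_le: "h V x \<le> m x" if "V \<in> \<V>" "x \<in> topspace X" for V x
  proof (cases "x \<in> V")
    case True
    then have "\<not> m x < h V x" 
      unfolding m_def locmax_less_iff[OF lf that(2)] using that(1) by auto
    then show ?thesis by simp
  next
    case False
    then show ?thesis using h_pos[OF that] m_pos[OF that(2)] by linarith
  qed
  \<comment> \<open>The supremum is a maximum by point-finiteness: if all values were below
    \<open>m x\<close>, then \<open>locmax_less_iff\<close> would give
    \<open>m x < m x\<close>.\<close>
  have att: "\<exists>V\<in>\<V>. h V x = m x" if x: "x \<in> topspace X" for x
  proof (rule ccontr)
    assume "\<not> ?thesis"
    then have "h V x < m x" if "V \<in> \<V>" for V using h_le[OF that x] that by force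
    then have "m x < m x" using m_pos[OF x] locmax_less_iff[OF lf x, of h "m x"] unfolding m_def by blast
    then show False by simp
  qed
  have "peaked_functions X \<V> (\<lambda>V x. h V x / m x)"
    unfolding peaked_functions_def
  proof (intro conjI ballI)
    fix V assume V: "V \<in> \<V>"
    show "continuous_map X euclideanreal (\<lambda>x. h V x / m x)"
      using h_cont[OF V] m_cont m_pos by (intro continuous_map_real_divide) force+
    fix x assume x: "x \<in> topspace X"
    show "0 \<le> h V x / m x" "h V x / m x \<le> 1" "(0 < h V x / m x) = (x \<in> V)"
      using m_pos[OF x] h_le[OF V x] h_pos[OF V x] by (auto simp: h_def zero_less_divide_iff)
  next
    fix x assume x: "x \<in> topspace X"
    then obtain V where "V \<in> \<V>" "h V x = m x" using att by blast
    then show "\<exists>V\<in>\<V>. h V x / m x = 1" using m_pos[OF x] by (intro bexI[of _ V]) auto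
  qed
  then show ?thesis by blast
qed

text \<open>The function defining \<open>U\<close> lives on the closed set only. Multiplied by
  \<open>f x - c\<close> it vanishes where \<open>f x = c\<close>, so extension by 0 is continuous
  on all of \<open>X\<close>.\<close>

lemma cozero_in_Int_extend:
  assumes f: "continuous_map X euclideanreal f"
    and U: "cozero_in (subtopology X {x \<in> topspace X. c \<le> f x}) U"
  shows "cozero_in X (U \<inter> {x \<in> topspace X. c < f x})"
proof -
  let ?F = "{x \<in> topspace X. c \<le> f x}"
  obtain h where h: "continuous_map (subtopology X ?F) euclideanreal h"
      "U = {x \<in> topspace (subtopology X ?F). h x \<noteq> 0}"
    using U unfolding cozero_in_def by blast
  let ?k = "\<lambda>x. if c \<le> f x then h x * (f x - c) else 0"
  have "continuous_map X euclideanreal ?k"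
  proof (rule continuous_map_cases_le)
    show "continuous_map (subtopology X ?F) euclideanreal (\<lambda>x. h x * (f x - c))"
      by (intro continuous_map_real_mult h(1) continuous_map_diff continuous_map_from_subtopology[OF f]) simp
  qed (use f in auto)
  moreover have "U \<inter> {x \<in> topspace X. c < f x} = {x \<in> topspace X. ?k x \<noteq> 0}"
    using h(2) by auto
  ultimately show ?thesis unfolding cozero_in_def by blast
qed

text \<open>Factorizability is applied, with singleton values \<open>{S x}\<close>, on each closed
  set \<open>F W\<close> separately: this forces the sample points to lie in the same old member as
  the pieces. Cutting the pieces down to \<open>I W\<close> makes them cozero in \<open>X\<close>,
  and they still cover because some \<open>l W x\<close> equals 1.\<close>

lemma slsf_refines_cover:
  assumes slsf: "slsf X E d \<Psi>" and "Metric_space E d"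
    and cover: "cozero_cover X \<W>" and "\<epsilon> > 0"
    and S: "\<And>x. x \<in> topspace X \<Longrightarrow> S x \<in> \<Psi> x" "\<And>x. x \<in> topspace X \<Longrightarrow> S x \<in> E"
  shows "\<exists>\<V> p. cozero_cover X \<V> \<and>
           (\<forall>V\<in>\<V>. (\<exists>W\<in>\<W>. V \<subseteq> W \<and> p V \<in> W) \<and> (\<forall>x\<in>V. \<exists>T\<in>\<Psi> x. T \<in> E \<and> d T (S (p V)) < \<epsilon>))"
proof -
  interpret E: Metric_space E d by fact
  obtain l where l: "peaked_functions X \<W> l" using peaked_functions_exist[OF cover] by blast
  have lc: "continuous_map X euclideanreal (l W)"
    and l_pos: "x \<in> topspace X \<Longrightarrow> 0 < l W x \<Longrightarrow> x \<in> W" if "W \<in> \<W>" for W x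
    using l that unfolding peaked_functions_def by auto
  define F where "F W = {x \<in> topspace X. 1/2 \<le> l W x}" for W
  define I where "I W = {x \<in> topspace X. 1/2 < l W x}" for W
  have FX: "F W \<subseteq> topspace X" for W by (auto simp: F_def)
  have FW: "F W \<subseteq> W" if "W \<in> \<W>" for W using l_pos[OF that] by (auto simp: F_def)
  have clo: "closedin X (F W)" if "W \<in> \<W>" for W
    using closedin_continuous_map_preimage[OF lc[OF that], of "{1/2..}"] by (simp add: F_def)
  have top: "topspace (subtopology X (F W)) = F W" for W using FX[of W] by (simp add: inf_absorb2)
  have "\<forall>W\<in>\<W>. \<exists>\<U> \<pi>. locally_finite_in (subtopology X (F W)) \<U> \<and> \<Union>\<U> = F W \<and>
           (\<forall>U\<in>\<U>. cozero_in (subtopology X (F W)) U) \<and> \<pi> \<in> \<U> \<rightarrow> F W \<and>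
           (\<forall>U\<in>\<U>. \<forall>x\<in>U. {S (\<pi> U)} \<subseteq> metric_nhd E d \<epsilon> (\<Psi> x))"
  proof
    fix W assume W: "W \<in> \<W>"
    have \<sigma>: "\<forall>x\<in>F W. {S x} \<in> compact_sets E.mtopology \<and> {S x} \<subseteq> \<Psi> x"
    proof
      fix x assume "x \<in> F W"
      then have "x \<in> topspace X" using FX by blast
      then show "{S x} \<in> compact_sets E.mtopology \<and> {S x} \<subseteq> \<Psi> x"
        using S by (simp add: compact_sets_def)
    qed
    from slsf[unfolded slsf_def, THEN spec, THEN spec, THEN spec, THEN mp,
        OF conjI[OF clo[OF W] conjI[OF \<open>\<epsilon> > 0\<close> \<sigma>]]]
    obtain \<U> \<pi> where "locally_finite_in (subtopology X (F W)) \<U>" "\<Union>\<U> = F W"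
        "\<forall>U\<in>\<U>. cozero_in (subtopology X (F W)) U" "\<pi> \<in> \<U> \<rightarrow> F W"
        "\<forall>U\<in>\<U>. \<forall>x\<in>U. {S (\<pi> U)} \<subseteq> metric_nhd E d \<epsilon> (\<Psi> x)"
      by (elim exE conjE)
    then show "\<exists>\<U> \<pi>. locally_finite_in (subtopology X (F W)) \<U> \<and> \<Union>\<U> = F W \<and>
           (\<forall>U\<in>\<U>. cozero_in (subtopology X (F W)) U) \<and> \<pi> \<in> \<U> \<rightarrow> F W \<and>
           (\<forall>U\<in>\<U>. \<forall>x\<in>U. {S (\<pi> U)} \<subseteq> metric_nhd E d \<epsilon> (\<Psi> x))"
      by (intro exI conjI)
  qed
  then obtain \<U> where "\<forall>W\<in>\<W>. \<exists>\<pi>. locally_finite_in (subtopology X (F W)) (\<U> W) \<and> \<Union>(\<U> W) = F W \<and>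
           (\<forall>U\<in>\<U> W. cozero_in (subtopology X (F W)) U) \<and> \<pi> \<in> \<U> W \<rightarrow> F W \<and>
           (\<forall>U\<in>\<U> W. \<forall>x\<in>U. {S (\<pi> U)} \<subseteq> metric_nhd E d \<epsilon> (\<Psi> x))"
    by (rule bchoice[THEN exE])
  then obtain \<pi> where "\<forall>W\<in>\<W>. locally_finite_in (subtopology X (F W)) (\<U> W) \<and> \<Union>(\<U> W) = F W \<and>
           (\<forall>U\<in>\<U> W. cozero_in (subtopology X (F W)) U) \<and> \<pi> W \<in> \<U> W \<rightarrow> F W \<and>
           (\<forall>U\<in>\<U> W. \<forall>x\<in>U. {S (\<pi> W U)} \<subseteq> metric_nhd E d \<epsilon> (\<Psi> x))"
    by (rule bchoice[THEN exE])
  then have U_lf: "locally_finite_in (subtopology X (F W)) (\<U> W)"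
    and U_cov: "\<Union>(\<U> W) = F W"
    and U_coz: "U \<in> \<U> W \<Longrightarrow> cozero_in (subtopology X (F W)) U"
    and U_pi: "U \<in> \<U> W \<Longrightarrow> \<pi> W U \<in> F W"
    and U_near: "U \<in> \<U> W \<Longrightarrow> x \<in> U \<Longrightarrow> S (\<pi> W U) \<in> metric_nhd E d \<epsilon> (\<Psi> x)"
    if "W \<in> \<W>" for W U x using that by auto
  define \<V> where "\<V> = (\<Union>W\<in>\<W>. (\<lambda>U. U \<inter> I W) ` \<U> W)"
  have lf: "locally_finite_in X \<W>" and \<W>_cov: "\<Union>\<W> = topspace X"
    using cover by (auto simp: cozero_cover_def)
  have V_lf: "locally_finite_in X \<V>"
    unfolding locally_finite_in_def
  proof (intro conjI ballI)
    show "\<Union>\<V> \<subseteq> topspace X" by (auto simp: \<V>_def I_def)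
    fix x assume x: "x \<in> topspace X"
    obtain O1 where O1: "openin X O1" "x \<in> O1" "finite {W \<in> \<W>. W \<inter> O1 \<noteq> {}}"
      using lf x unfolding locally_finite_in_def by blast
    \<comment> \<open>Local finiteness passes from the closed set \<open>F W\<close> to
      \<open>X\<close>: off \<open>F W\<close>, its complement is a neighbourhood meeting no
      piece.\<close>
    have "\<exists>O'. openin X O' \<and> x \<in> O' \<and> finite {U \<in> \<U> W. U \<inter> O' \<noteq> {}}" if W: "W \<in> \<W>" for W
    proof (cases "x \<in> F W")
      case True
      then obtain Q where Q: "openin (subtopology X (F W)) Q" "x \<in> Q" "finite {U \<in> \<U> W. U \<inter> Q \<noteq> {}}"
        using U_lf[OF W] unfolding locally_finite_in_def top by blast
      then obtain O' where O': "openin X O'" "Q = O' \<inter> F W" by (auto simp: openin_subtopology)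
      have "{U \<in> \<U> W. U \<inter> O' \<noteq> {}} \<subseteq> {U \<in> \<U> W. U \<inter> Q \<noteq> {}}"
        using U_cov[OF W] O'(2) by blast
      with Q(3) have "finite {U \<in> \<U> W. U \<inter> O' \<noteq> {}}" by (rule finite_subset[rotated])
      then show ?thesis using O' Q(2) by blast
    next
      case False
      have empty: "{U \<in> \<U> W. U \<inter> (topspace X - F W) \<noteq> {}} = {}" using U_cov[OF W] by blast
      have "finite {U \<in> \<U> W. U \<inter> (topspace X - F W) \<noteq> {}}" unfolding empty by simp
      then show ?thesis using clo[OF W] False x by (intro exI[of _ "topspace X - F W"]) (auto simp: closedin_def)
    qed
    then obtain O2 where O2: "\<And>W. W \<in> \<W> \<Longrightarrow> openin X (O2 W) \<and> x \<in> O2 W \<and> finite {U \<in> \<U> W. U \<inter> O2 W \<noteq> {}}"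
      by metis
    let ?A = "{W \<in> \<W>. W \<inter> O1 \<noteq> {}}"
    let ?Q = "\<Inter>(insert O1 (O2 ` ?A))"
    have "openin X ?Q" using O1 O2 by (intro openin_Inter) auto
    moreover have "x \<in> ?Q" using O1 O2 by auto
    moreover have "{V \<in> \<V>. V \<inter> ?Q \<noteq> {}} \<subseteq> (\<Union>W\<in>?A. (\<lambda>U. U \<inter> I W) ` {U \<in> \<U> W. U \<inter> O2 W \<noteq> {}})"
    proof
      fix V assume "V \<in> {V \<in> \<V>. V \<inter> ?Q \<noteq> {}}"
      then obtain W U z where z: "W \<in> \<W>" "U \<in> \<U> W" "V = U \<inter> I W" "z \<in> V" "z \<in> ?Q"
        unfolding \<V>_def by blast
      have "z \<in> F W" using U_cov[OF z(1)] z(2,3,4) by blast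
      then have "z \<in> W" using FW[OF z(1)] by blast
      then have "W \<in> ?A" using z(1,5) by blast
      moreover have "z \<in> U" "z \<in> O2 W" using z(3-5) \<open>W \<in> ?A\<close> by auto
      then have "U \<in> {U \<in> \<U> W. U \<inter> O2 W \<noteq> {}}" using z(2) by blast
      ultimately show "V \<in> (\<Union>W\<in>?A. (\<lambda>U. U \<inter> I W) ` {U \<in> \<U> W. U \<inter> O2 W \<noteq> {}})"
        unfolding z(3) by - (rule UN_I, assumption, rule imageI, assumption)
    qed
    then have "finite {V \<in> \<V>. V \<inter> ?Q \<noteq> {}}"
      by (rule finite_subset) (use O1(3) O2 in auto)
    ultimately show "\<exists>Q. openin X Q \<and> x \<in> Q \<and> finite {V \<in> \<V>. V \<inter> Q \<noteq> {}}" by blast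
  qed
  have V_cov: "\<Union>\<V> = topspace X"
  proof
    show "\<Union>\<V> \<subseteq> topspace X" by (auto simp: \<V>_def I_def)
    show "topspace X \<subseteq> \<Union>\<V>"
    proof
      fix x assume x: "x \<in> topspace X"
      then obtain W where W: "W \<in> \<W>" "l W x = 1" using l unfolding peaked_functions_def by blast
      then have "x \<in> F W" "x \<in> I W" using x by (auto simp: F_def I_def)
      then obtain U where "U \<in> \<U> W" "x \<in> U" using U_cov[OF W(1)] by blast
      with W \<open>x \<in> I W\<close> show "x \<in> \<Union>\<V>" unfolding \<V>_def by blast
    qed
  qed
  have "cozero_in X V" if V: "V \<in> \<V>" for V
  proof -
    obtain W U where WU: "W \<in> \<W>" "U \<in> \<U> W" "V = U \<inter> I W" using V unfolding \<V>_def by blast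
    show ?thesis
      using cozero_in_Int_extend[OF lc[OF WU(1)], of "1/2" U] U_coz[OF WU(1,2)] WU(3)
      by (simp add: F_def I_def)
  qed
  with V_lf V_cov have "cozero_cover X \<V>" by (simp add: cozero_cover_def)
  \<comment> \<open>The same set may arise from several pairs of \<open>W\<close> and
    \<open>U\<close>, so \<open>p\<close> is chosen only now, as a function of the resulting
    set.\<close>
  moreover have "\<exists>y. (\<exists>W\<in>\<W>. V \<subseteq> W \<and> y \<in> W) \<and> (\<forall>x\<in>V. \<exists>T\<in>\<Psi> x. T \<in> E \<and> d T (S y) < \<epsilon>)" if V: "V \<in> \<V>" for V
  proof -
    obtain W U where WU: "W \<in> \<W>" "U \<in> \<U> W" "V = U \<inter> I W" using V unfolding \<V>_def by blast
    have "V \<subseteq> W" using WU U_cov FW by blast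
    moreover have "\<pi> W U \<in> W" using U_pi[OF WU(1,2)] FW[OF WU(1)] by blast
    moreover have "\<exists>T\<in>\<Psi> x. T \<in> E \<and> d T (S (\<pi> W U)) < \<epsilon>" if "x \<in> V" for x
      using U_near[OF WU(1,2), of x] that WU(3) by (auto simp: metric_nhd_def)
    ultimately show ?thesis using WU(1) by blast
  qed
  then obtain p where "\<And>V. V \<in> \<V> \<Longrightarrow> (\<exists>W\<in>\<W>. V \<subseteq> W \<and> p V \<in> W) \<and> (\<forall>x\<in>V. \<exists>T\<in>\<Psi> x. T \<in> E \<and> d T (S (p V)) < \<epsilon>)"
    by metis
  ultimately show ?thesis by blast
qed

text \<open>The mesh \<open>1 / D \<tau>\<close> may depend on the finite set \<open>\<tau>\<close>
  of members that can have weight at least 1/2; it will be matched to the sizes of their nets, for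
  which no global bound exists in general. A member of the new cover is given by
  \<open>\<tau>\<close> and a grid cell for the weights of its elements.\<close>

lemma cozero_cover_fine_oscillation:
  fixes D :: "'a set set \<Rightarrow> nat"
  assumes cover: "cozero_cover X \<V>" and l: "peaked_functions X \<V> l" and D: "\<And>\<tau>. D \<tau> \<ge> 4"
  shows "\<exists>\<W>. cozero_cover X \<W> \<and> (\<forall>W\<in>\<W>. \<exists>\<tau>. finite \<tau> \<and> \<tau> \<subseteq> \<V> \<and>
     (\<forall>x\<in>W. (\<forall>V\<in>\<tau>. x \<in> V) \<and> (\<forall>V\<in>\<V> - \<tau>. l V x < 1/2)) \<and>
     (\<forall>x\<in>W. \<forall>y\<in>W. \<forall>V\<in>\<tau>. \<bar>l V x - l V y\<bar> < 2 / D \<tau>))"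
proof -
  have lf: "locally_finite_in X \<V>" and cov: "\<Union>\<V> = topspace X"
    using cover by (auto simp: cozero_cover_def)
  have lc: "continuous_map X euclideanreal (l V)" if "V \<in> \<V>" for V
    using l that unfolding peaked_functions_def by blast
  have l01: "0 \<le> l V x" "l V x \<le> 1" "0 < l V x \<longleftrightarrow> x \<in> V" if "V \<in> \<V>" "x \<in> topspace X" for V x
    using l that unfolding peaked_functions_def by auto
  have D0: "real (D \<tau>) > 0" for \<tau> using D[of \<tau>] by simp
  define rest where "rest \<tau> = locmax (\<V> - \<tau>) l" for \<tau>
  have rest_lf: "locally_finite_in X (\<V> - \<tau>)" for \<tau> using locally_finite_in_subset[OF lf] by blast
  have rest_cont: "continuous_map X euclideanreal (rest \<tau>)" for \<tau>
    unfolding rest_def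
    by (rule continuous_map_locmax[OF rest_lf]) (use lc l01 in \<open>auto simp: order.order_iff_strict\<close>)
  define w where "w \<tau> a = {x \<in> topspace X. rest \<tau> x < 1/2 \<and> (\<forall>V\<in>\<tau>. \<bar>l V x - a V / D \<tau>\<bar> < 1 / D \<tau>)}"
    for \<tau> and a :: "'a set \<Rightarrow> nat"
  \<comment> \<open>Grid indices start at 1, so all weights from \<open>\<tau>\<close> are positive
    on \<open>w \<tau> a\<close>. A set meeting finitely many members of \<open>\<V>\<close>
    therefore meets only finitely many of the new sets.\<close>
  define Idx where "Idx = (SIGMA \<tau>:{\<tau>. finite \<tau> \<and> \<tau> \<subseteq> \<V>}. PiE \<tau> (\<lambda>_. {1..D \<tau>}))"
  define \<W> where "\<W> = (\<lambda>(\<tau>, a). w \<tau> a) ` Idx"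
  have w_in: "x \<in> V" if "(\<tau>, a) \<in> Idx" "x \<in> w \<tau> a" "V \<in> \<tau>" for \<tau> a x V
  proof -
    have "V \<in> \<V>" "a V \<ge> 1" "x \<in> topspace X" "\<bar>l V x - a V / D \<tau>\<bar> < 1 / D \<tau>"
      using that by (auto simp: Idx_def w_def)
    moreover have "1 / D \<tau> \<le> a V / D \<tau>" using \<open>a V \<ge> 1\<close> by (simp add: divide_right_mono)
    ultimately have "0 < l V x" by linarith
    then show ?thesis using l01(3)[OF \<open>V \<in> \<V>\<close> \<open>x \<in> topspace X\<close>] by blast
  qed
  have "cozero_in X W" if W: "W \<in> \<W>" for W
  proof -
    obtain \<tau> a where \<tau>: "finite \<tau>" "\<tau> \<subseteq> \<V>" "W = w \<tau> a" using W unfolding \<W>_def Idx_def by auto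
    \<comment> \<open>Positive parts of the defining strict inequalities are multiplied;
      \<open>rest\<close> has condensed the conditions on all members outside \<open>\<tau>\<close>
      into a single continuous function.\<close>
    let ?k = "\<lambda>x. max 0 (1/2 - rest \<tau> x) * (\<Prod>V\<in>\<tau>. max 0 (1 / D \<tau> - \<bar>l V x - a V / D \<tau>\<bar>))"
    have "continuous_map X euclideanreal ?k"
      using \<tau>(2) by (intro continuous_map_real_mult continuous_map_real_max continuous_map_diff
          continuous_map_prod \<tau>(1) continuous_map_real_abs rest_cont lc) auto
    moreover have "max 0 r \<noteq> 0 \<longleftrightarrow> 0 < r" for r :: real by linarith
    then have "W = {x \<in> topspace X. ?k x \<noteq> 0}"
      using \<tau>(1) unfolding \<tau>(3) w_def by auto
    ultimately show ?thesis unfolding cozero_in_def by blast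
  qed
  moreover have "\<Union>\<W> = topspace X"
  proof
    show "\<Union>\<W> \<subseteq> topspace X" by (auto simp: \<W>_def w_def)
    show "topspace X \<subseteq> \<Union>\<W>"
    proof
      fix x assume x: "x \<in> topspace X"
      \<comment> \<open>The threshold 1/4 lies below 1/2, which makes the bound on
        \<open>rest\<close> strict, and together with \<open>D \<tau> \<ge> 4\<close> it yields grid
        indices of at least 1.\<close>
      define \<tau> where "\<tau> = {V \<in> \<V>. x \<in> V \<and> 1/4 < l V x}"
      define a where "a = restrict (\<lambda>V. nat \<lfloor>D \<tau> * l V x\<rfloor>) \<tau>"
      have fin: "finite \<tau>"
        using locally_finite_in_imp_point_finite[OF lf x] by (rule finite_subset[rotated]) (auto simp: \<tau>_def)
      have a_eq: "real (a V) \<le> D \<tau> * l V x" "D \<tau> * l V x < a V + 1" "1 \<le> a V" "a V \<le> D \<tau>" if V: "V \<in> \<tau>" for V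
      proof -
        have lV: "1/4 < l V x" "l V x \<le> 1" using V l01[of V x] x by (auto simp: \<tau>_def)
        have "4 * (1/4) \<le> D \<tau> * l V x" using lV D[of \<tau>] by (intro mult_mono) auto
        then have 1: "1 \<le> \<lfloor>D \<tau> * l V x\<rfloor>" by simp
        have "real (D \<tau>) * l V x \<le> real (D \<tau>) * 1" using lV by (intro mult_left_mono) auto
        then have 2: "\<lfloor>D \<tau> * l V x\<rfloor> \<le> int (D \<tau>)" by linarith
        show "real (a V) \<le> D \<tau> * l V x" "D \<tau> * l V x < a V + 1" "1 \<le> a V" "a V \<le> D \<tau>"
          using V 1 2 by (auto simp: a_def; linarith)+
      qed
      have "x \<in> w \<tau> a"
        unfolding w_def
      proof (intro CollectI conjI ballI x)
        show "rest \<tau> x < 1/2"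
          unfolding rest_def locmax_less_iff[OF rest_lf x] by (auto simp: \<tau>_def)
        fix V assume V: "V \<in> \<tau>"
        have "a V / D \<tau> \<le> l V x" "l V x < a V / D \<tau> + 1 / D \<tau>"
          using a_eq(1,2)[OF V] D0[of \<tau>] by (simp_all add: field_simps)
        then show "\<bar>l V x - a V / D \<tau>\<bar> < 1 / D \<tau>" by linarith
      qed
      moreover have "(\<tau>, a) \<in> Idx" using fin a_eq(3,4) by (auto simp: Idx_def \<tau>_def a_def)
      ultimately show "x \<in> \<Union>\<W>" unfolding \<W>_def by force
    qed
  qed
  moreover have "locally_finite_in X \<W>"
    unfolding locally_finite_in_def
  proof (intro conjI ballI)
    show "\<Union>\<W> \<subseteq> topspace X" by (auto simp: \<W>_def w_def)
    fix x assume "x \<in> topspace X"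
    then obtain Q where Q: "openin X Q" "x \<in> Q" "finite {V \<in> \<V>. V \<inter> Q \<noteq> {}}"
      using lf unfolding locally_finite_in_def by blast
    let ?J = "SIGMA \<tau>:Pow {V \<in> \<V>. V \<inter> Q \<noteq> {}}. PiE \<tau> (\<lambda>_. {1..D \<tau>})"
    have "{W \<in> \<W>. W \<inter> Q \<noteq> {}} \<subseteq> (\<lambda>(\<tau>, a). w \<tau> a) ` ?J"
    proof
      fix W assume "W \<in> {W \<in> \<W>. W \<inter> Q \<noteq> {}}"
      then obtain \<tau> a z where z: "(\<tau>, a) \<in> Idx" "W = w \<tau> a" "z \<in> W" "z \<in> Q"
        unfolding \<W>_def by auto
      have "V \<inter> Q \<noteq> {}" if "V \<in> \<tau>" for V using w_in[OF z(1) _ that] z by blast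
      then have "(\<tau>, a) \<in> ?J" using z(1) by (auto simp: Idx_def)
      then show "W \<in> (\<lambda>(\<tau>, a). w \<tau> a) ` ?J" unfolding z(2) by (rule rev_image_eqI) simp
    qed
    moreover have "finite ?J"
    proof (rule finite_SigmaI)
      show "finite (Pow {V \<in> \<V>. V \<inter> Q \<noteq> {}})" using Q(3) by simp
      fix \<tau> assume "\<tau> \<in> Pow {V \<in> \<V>. V \<inter> Q \<noteq> {}}"
      then have "finite \<tau>" using Q(3) finite_subset by blast
      then show "finite (PiE \<tau> (\<lambda>_. {1..D \<tau>}))" by (intro finite_PiE) auto
    qed
    ultimately have "finite {W \<in> \<W>. W \<inter> Q \<noteq> {}}" by (rule finite_subset[OF _ finite_imageI])
    then show "\<exists>Q. openin X Q \<and> x \<in> Q \<and> finite {W \<in> \<W>. W \<inter> Q \<noteq> {}}" using Q by blast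
  qed
  ultimately have "cozero_cover X \<W>" by (simp add: cozero_cover_def)
  moreover have "\<exists>\<tau>. finite \<tau> \<and> \<tau> \<subseteq> \<V> \<and>
     (\<forall>x\<in>W. (\<forall>V\<in>\<tau>. x \<in> V) \<and> (\<forall>V\<in>\<V> - \<tau>. l V x < 1/2)) \<and>
     (\<forall>x\<in>W. \<forall>y\<in>W. \<forall>V\<in>\<tau>. \<bar>l V x - l V y\<bar> < 2 / D \<tau>)" if W: "W \<in> \<W>" for W
  proof -
    obtain \<tau> a where \<tau>: "(\<tau>, a) \<in> Idx" "W = w \<tau> a" using W unfolding \<W>_def by auto
    have "l V x < 1/2" if x: "x \<in> W" and V: "V \<in> \<V> - \<tau>" for x V
    proof (cases "x \<in> V")
      case True
      have "x \<in> topspace X" "rest \<tau> x < 1/2" using x \<tau>(2) by (auto simp: w_def)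
      then show ?thesis using locmax_less_iff[OF rest_lf] V True unfolding rest_def by blast
    next
      case False
      have "x \<in> topspace X" using x \<tau>(2) by (auto simp: w_def)
      then show ?thesis using l01(3)[of V x] False V by auto
    qed
    moreover have "\<bar>l V x - l V y\<bar> < 2 / D \<tau>" if x: "x \<in> W" and y: "y \<in> W" and V: "V \<in> \<tau>" for x y V
    proof -
      have "\<bar>l V x - a V / D \<tau>\<bar> < 1 / D \<tau>" "\<bar>l V y - a V / D \<tau>\<bar> < 1 / D \<tau>"
        using x y V \<tau>(2) by (auto simp: w_def)
      then have "\<bar>l V x - l V y\<bar> < 1 / D \<tau> + 1 / D \<tau>" by linarith
      then show ?thesis by simp
    qed
    ultimately show ?thesis
      using \<tau> w_in[OF \<tau>(1)] by (intro exI[of _ \<tau>]) (auto simp: Idx_def)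
  qed
  ultimately show ?thesis by blast
qed

section \<open>The approximating systems\<close>

context Metric_space
begin

text \<open>Initial segments of an affordable walk are affordable, so each endpoint is linked to the
  one before. A starting net has weight zero, hence is reached entirely, as is the net of
  \<open>U\<close>, and the two touch.\<close>

lemma chained_reached:
  assumes chained: "\<And>V. V \<in> \<tau> \<Longrightarrow> chained d e (R V)"
    and touch: "\<And>V V'. V \<in> \<tau> \<Longrightarrow> V' \<in> \<tau> \<Longrightarrow> \<exists>a\<in>R V. \<exists>b\<in>R V'. d a b < e"
    and w: "\<And>V. V \<in> \<tau> \<Longrightarrow> 0 \<le> w V" and U: "U \<in> \<tau>" "w U = 0"
  shows "chained d e (reached d e \<tau> R w)"
proof -
  let ?L = "link d e (reached d e \<tau> R w)"
  obtain u where u: "u \<in> R U" using touch[OF U(1) U(1)] by blast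
  have "(u, snd (last p)) \<in> ?L\<^sup>*" if "walk d e \<tau> R p" "w (fst (hd p)) = 0" "cost w p \<le> 1" for p
    using that
  proof (induction p rule: rev_induct)
    case Nil
    then show ?case by (simp add: walk_def)
  next
    case (snoc v p)
    obtain V s where v: "v = (V, s)" by (cases v) auto
    have V: "V \<in> \<tau>" "s \<in> R V" using snoc.prems(1) by (auto simp: walk_def v)
    show ?case
    proof (cases "p = []")
      case True
      then have "w V = 0" using snoc.prems(2) v by simp
      obtain a b where ab: "a \<in> R U" "b \<in> R V" "d a b < e" using touch[OF U(1) V(1)] by blast
      have sub: "R U \<subseteq> reached d e \<tau> R w" "R V \<subseteq> reached d e \<tau> R w"
        using subset_reached[of U \<tau> w R, OF U] subset_reached[of V \<tau> w R, OF V(1) \<open>w V = 0\<close>] by auto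
      have "(u, a) \<in> ?L\<^sup>*"
        by (rule chained_imp_rtrancl[OF chained[OF U(1)] u ab(1) sub(1) order.refl])
      moreover have "(a, b) \<in> ?L" using ab sub by (auto simp: link_def)
      moreover have "(b, s) \<in> ?L\<^sup>*"
        by (rule chained_imp_rtrancl[OF chained[OF V(1)] ab(2) V(2) sub(2) order.refl])
      ultimately have "(u, s) \<in> ?L\<^sup>*" by (meson rtrancl.rtrancl_into_rtrancl rtrancl_trans)
      then show ?thesis using True v by simp
    next
      case False
      have p: "walk d e \<tau> R p" "d (snd (last p)) s < e"
        using snoc.prems(1) False v by (auto simp: walk_def successively_append_iff)
      have hd: "w (fst (hd p)) = 0" using snoc.prems(2) False by simp
      have "cost w p \<le> 1" using snoc.prems(3) w[OF V(1)] v by simp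
      from snoc.IH[OF p(1) hd this] have "(u, snd (last p)) \<in> ?L\<^sup>*" .
      moreover have "snd (last p) \<in> reached d e \<tau> R w"
        using p(1) hd \<open>cost w p \<le> 1\<close> unfolding reached_def by blast
      moreover have "snd (last (p @ [v])) \<in> reached d e \<tau> R w"
        using snoc.prems unfolding reached_def by blast
      ultimately show ?thesis
        using p(2) v by (auto simp: link_def intro: rtrancl.rtrancl_into_rtrancl)
    qed
  qed
  then show ?thesis
    by (intro chainedI_base[of _ u]) (auto simp: reached_def)
qed

text \<open>One step of the recursion. The last two clauses confine the new values between continua
  sampled within the old members around \<open>x\<close>; through the small oscillation on the old
  cover this controls the distance from the old map.\<close>

lemma quasi_continuum_system:
  assumes slsf: "slsf X (compact_connected_sets mtopology) (hausdorff_distance M d) (cc_between mtopology \<theta> \<Phi>)"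
    and cover: "cozero_cover X \<W>"
    and S: "\<And>x. x \<in> topspace X \<Longrightarrow> S x \<in> cc_between mtopology \<theta> \<Phi> x"
    and \<theta>: "\<And>x. x \<in> topspace X \<Longrightarrow> \<theta> x \<noteq> {}" and "\<delta> > 0"
  shows "\<exists>\<W>' f. cozero_cover X \<W>' \<and>
     (\<forall>x\<in>topspace X. quasi_continuum \<delta> (\<Phi> x) (\<theta> x) (f x)) \<and>
     (\<forall>W\<in>\<W>'. \<forall>x\<in>W. \<forall>y\<in>W. hclose \<delta> (f x) (f y)) \<and>
     (\<forall>x\<in>topspace X. (\<forall>z\<in>f x. \<exists>W\<in>\<W>. \<exists>y\<in>W. x \<in> W \<and> z \<in> S y) \<and>
        (\<exists>W\<in>\<W>. \<exists>y\<in>W. x \<in> W \<and> S y \<subseteq> nhd \<delta> (f x)))"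
proof -
  have cc: "compact_connected_sets mtopology \<subseteq> compact_sets mtopology"
    by (auto simp: compact_connected_sets_def)
  have ms: "Metric_space (compact_connected_sets mtopology) (hausdorff_distance M d)"
    by (rule Metric_space.subspace[OF Metric_space_hausdorff_distance cc])
  \<comment> \<open>One quarter is spent on the sampling by \<open>p\<close> and one on the finite
    net. Every net around \<open>x\<close> is then within \<open>\<delta>/2\<close> of
    \<open>\<theta> x\<close>, so two such nets touch within \<open>\<delta>\<close>.\<close>
  have \<delta>4: "\<delta>/4 > 0" using \<open>\<delta> > 0\<close> by simp
  have S_cc: "S x \<in> compact_connected_sets mtopology" if "x \<in> topspace X" for x
    using S[OF that] by (simp add: cc_between_def)
  have "\<exists>\<V> p. cozero_cover X \<V> \<and>
      (\<forall>V\<in>\<V>. (\<exists>W\<in>\<W>. V \<subseteq> W \<and> p V \<in> W) \<and> (\<forall>x\<in>V. \<exists>T\<in>cc_between mtopology \<theta> \<Phi> x.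
        T \<in> compact_connected_sets mtopology \<and> hausdorff_distance M d T (S (p V)) < \<delta>/4))"
    by (rule slsf_refines_cover[OF slsf ms cover \<delta>4]) (use S S_cc in auto)
  then obtain \<V> p where V_cover: "cozero_cover X \<V>"
    and p': "\<forall>V\<in>\<V>. (\<exists>W\<in>\<W>. V \<subseteq> W \<and> p V \<in> W) \<and> (\<forall>x\<in>V. \<exists>T\<in>cc_between mtopology \<theta> \<Phi> x.
        T \<in> compact_connected_sets mtopology \<and> hausdorff_distance M d T (S (p V)) < \<delta>/4)"
    by (elim exE conjE)
  have \<W>X: "W \<subseteq> topspace X" if "W \<in> \<W>" for W
    using cover that by (auto simp: cozero_cover_def)
  have \<V>X: "V \<subseteq> topspace X" if "V \<in> \<V>" for V
    using V_cover that by (auto simp: cozero_cover_def)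
  have p: "\<exists>W\<in>\<W>. V \<subseteq> W \<and> p V \<in> W" "p V \<in> topspace X" if "V \<in> \<V>" for V
    using p' that \<W>X by blast+
  have "\<exists>K. finite K \<and> K \<subseteq> S (p V) \<and> S (p V) \<subseteq> nhd (\<delta>/4) K" if V: "V \<in> \<V>" for V
  proof -
    have "compactin mtopology (S (p V))"
      using S_cc[OF p(2)[OF V]] cc by (auto simp: compact_sets_def)
    then show ?thesis using compactin_finite_net[OF _ \<delta>4] by metis
  qed
  then obtain R where R: "\<And>V. V \<in> \<V> \<Longrightarrow> finite (R V) \<and> R V \<subseteq> S (p V) \<and> S (p V) \<subseteq> nhd (\<delta>/4) (R V)"
    by metis
  have SM: "S x \<subseteq> M" if "x \<in> topspace X" for x
    using S_cc[OF that] connectedin_subset_topspace by (fastforce simp: compact_connected_sets_def)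
  have RM: "R V \<subseteq> M" if "V \<in> \<V>" for V using R[OF that] SM p(2)[OF that] by blast
  have R_chained: "chained d \<delta> (R V)" if V: "V \<in> \<V>" for V
  proof -
    have "chained d (\<delta>/4) (S (p V))"
      using S_cc[OF p(2)[OF V]] by (intro connectedin_imp_chained \<delta>4) (simp add: compact_connected_sets_def)
    moreover have "hclose (\<delta>/4) (R V) (S (p V))"
      using R[OF V] subset_nhd_mono[OF subset_nhd_self[OF RM[OF V] \<delta>4], of "S (p V)" "\<delta>/4"]
      by (simp add: hclose_def)
    ultimately have "chained d (\<delta>/4 + 2 * (\<delta>/4)) (R V)" using \<delta>4 by (intro chained_hclose) auto
    then show ?thesis by (rule chained_mono) (use \<open>\<delta> > 0\<close> in simp)
  qed
  have R_near: "R V \<subseteq> nhd \<delta> (\<Phi> x)" "\<theta> x \<subseteq> nhd (\<delta>/2) (R V)" if V: "V \<in> \<V>" and x: "x \<in> V" for V x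
  proof -
    obtain T where T: "T \<in> cc_between mtopology \<theta> \<Phi> x" "T \<in> compact_connected_sets mtopology"
        "hausdorff_distance M d T (S (p V)) < \<delta>/4"
      using p' V x by blast
    then have T': "\<theta> x \<subseteq> T" "T \<subseteq> \<Phi> x" by (auto simp: cc_between_def)
    have 1: "T \<subseteq> nhd (\<delta>/4) (S (p V))" "S (p V) \<subseteq> nhd (\<delta>/4) T"
      using hausdorff_distance_less[OF _ _ T(3)] T(2) S_cc[OF p(2)[OF V]] cc by blast+
    have "S (p V) \<subseteq> nhd \<delta> (\<Phi> x)" by (rule subset_nhd_mono[OF 1(2) T'(2)]) (use \<open>\<delta> > 0\<close> in simp)
    then show "R V \<subseteq> nhd \<delta> (\<Phi> x)" using R[OF V] by (meson order_trans)
    have "T \<subseteq> nhd (\<delta>/4 + \<delta>/4) (R V)" using metric_nhd_trans[OF 1(1)] R[OF V] by blast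
    then show "\<theta> x \<subseteq> nhd (\<delta>/2) (R V)" using T'(1) by (simp add: field_simps)
  qed
  obtain l where l: "peaked_functions X \<V> l" using peaked_functions_exist[OF V_cover] by blast
  have l01: "0 \<le> l V x" "l V x \<le> 1" if "V \<in> \<V>" "x \<in> topspace X" for V x
    using l that unfolding peaked_functions_def by auto
  define w where "w x V = 2 * (1 - l V x)" for x V
  define star where "star x = {V \<in> \<V>. x \<in> V}" for x
  define f where "f x = reached d \<delta> (star x) R (w x)" for x
  have star_fin: "finite (star x)" if "x \<in> topspace X" for x
    unfolding star_def using V_cover that by (intro locally_finite_in_imp_point_finite) (auto simp: cozero_cover_def)
  have w_nonneg: "0 \<le> w x V" if "V \<in> star x" for x V
    using that l01[of V x] \<V>X by (auto simp: star_def w_def)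
  have top: "\<exists>U\<in>star x. w x U = 0" if x: "x \<in> topspace X" for x
  proof -
    obtain U where U: "U \<in> \<V>" "l U x = 1" using l x unfolding peaked_functions_def by blast
    then have "x \<in> U" using l x unfolding peaked_functions_def by force
    with U show ?thesis by (intro bexI[of _ U]) (auto simp: star_def w_def)
  qed
  have touch: "\<exists>a\<in>R V. \<exists>b\<in>R V'. d a b < \<delta>" if V: "V \<in> star x" and V': "V' \<in> star x" for x V V'
  proof -
    have VV: "V \<in> \<V>" "x \<in> V" "V' \<in> \<V>" "x \<in> V'" using V V' by (auto simp: star_def)
    obtain t where t: "t \<in> \<theta> x" using \<theta> VV(1,2) \<V>X by blast
    obtain a where a: "a \<in> R V" "a \<in> M" "t \<in> M" "d a t < \<delta>/2"
      using subset_nhdD[OF R_near(2)[OF VV(1,2)] t] by blast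
    obtain b where b: "b \<in> R V'" "b \<in> M" "d b t < \<delta>/2"
      using subset_nhdD[OF R_near(2)[OF VV(3,4)] t] by blast
    have "d a b \<le> d a t + d b t" using triangle[of a t b] a b commute[of b t] by simp
    then show ?thesis using a b by force
  qed
  have chained_at: "chained d \<delta> (R V)" and fin_at: "finite (R V)" and M_at: "R V \<subseteq> M" if "V \<in> star x" for x V
    using that R_chained R RM by (auto simp: star_def)
  have fX: "quasi_continuum \<delta> (\<Phi> x) (\<theta> x) (f x)" if x: "x \<in> topspace X" for x
  proof -
    obtain U where U: "U \<in> star x" "w x U = 0" using top[OF x] by blast
    have sub: "f x \<subseteq> (\<Union>V\<in>star x. R V)" unfolding f_def by (rule reached_subset)
    have U_sub: "R U \<subseteq> f x" unfolding f_def by (rule subset_reached[of U "star x" "w x", OF U])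
    have U': "U \<in> \<V>" "x \<in> U" using U by (auto simp: star_def)
    have "finite (f x)" by (rule finite_subset[OF sub]) (use star_fin[OF x] fin_at in blast)
    moreover have "f x \<noteq> {}" using U_sub touch[OF U(1) U(1)] by blast
    moreover have "f x \<subseteq> nhd \<delta> (\<Phi> x)"
    proof
      fix z assume "z \<in> f x"
      then obtain V where "V \<in> star x" "z \<in> R V" using sub by blast
      then show "z \<in> nhd \<delta> (\<Phi> x)" using R_near(1)[of V x] by (auto simp: star_def)
    qed
    moreover have "\<theta> x \<subseteq> nhd \<delta> (f x)"
      by (rule subset_nhd_mono[OF R_near(2)[OF U'] U_sub]) (use \<open>\<delta> > 0\<close> in simp)
    moreover have "chained d \<delta> (f x)"
      unfolding f_def by (rule chained_reached[where U = U]) (use chained_at touch w_nonneg U in auto)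
    ultimately show ?thesis by (simp add: quasi_continuum_def)
  qed
  \<comment> \<open>Weights in \<open>\<tau>\<close> will vary by less than
    \<open>2 / (8 * N\<tau>\<^sup>2)\<close>, written loosely, hence prices by less than twice that;
    this is the value of \<open>\<eta>\<close> for which the budget condition of
    \<open>reached_perturb\<close> holds with equality.\<close>
  define N where "N \<tau> = Suc (\<Sum>V\<in>\<tau>. card (R V))" for \<tau>
  have "4 \<le> 8 * N \<tau> * N \<tau>" for \<tau> by (simp add: N_def)
  from cozero_cover_fine_oscillation[OF V_cover l, of "\<lambda>\<tau>. 8 * N \<tau> * N \<tau>", OF this]
  obtain \<W>' where W'_cover: "cozero_cover X \<W>'"
    and \<W>': "\<forall>W\<in>\<W>'. \<exists>\<tau>. finite \<tau> \<and> \<tau> \<subseteq> \<V> \<and>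
     (\<forall>x\<in>W. (\<forall>V\<in>\<tau>. x \<in> V) \<and> (\<forall>V\<in>\<V> - \<tau>. l V x < 1/2)) \<and>
     (\<forall>x\<in>W. \<forall>y\<in>W. \<forall>V\<in>\<tau>. \<bar>l V x - l V y\<bar> < 2 / real (8 * N \<tau> * N \<tau>))" by (elim exE conjE)
  have osc: "f x \<subseteq> nhd \<delta> (f y)" if W: "W \<in> \<W>'" and x: "x \<in> W" and y: "y \<in> W" for W x y
  proof
    fix z assume z: "z \<in> f x"
    from bspec[OF \<W>' W] obtain \<tau> where "finite \<tau>" "\<tau> \<subseteq> \<V>"
      and \<tau>': "\<forall>x\<in>W. (\<forall>V\<in>\<tau>. x \<in> V) \<and> (\<forall>V\<in>\<V> - \<tau>. l V x < 1/2)"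
        "\<forall>x\<in>W. \<forall>y\<in>W. \<forall>V\<in>\<tau>. \<bar>l V x - l V y\<bar> < 2 / real (8 * N \<tau> * N \<tau>)"
      by (elim exE conjE)
    have \<tau>: "V \<in> \<tau> \<Longrightarrow> y \<in> V" "V \<in> \<V> \<Longrightarrow> V \<notin> \<tau> \<Longrightarrow> l V x < 1/2"
        "V \<in> \<tau> \<Longrightarrow> \<bar>l V x - l V y\<bar> < 2 / real (8 * N \<tau> * N \<tau>)" for V
      using bspec[OF \<tau>'(1) x] bspec[OF \<tau>'(1) y] bspec[OF bspec[OF \<tau>'(2) x] y] by simp_all
    have xyX: "x \<in> topspace X" "y \<in> topspace X"
      using W x y W'_cover by (auto simp: cozero_cover_def)
    \<comment> \<open>Affordable at \<open>x\<close> means weight at least 1/2, so these members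
      belong to \<open>\<tau>\<close> and also contain \<open>y\<close>. Only their nets are counted
      in \<open>N \<tau>\<close>; the star of \<open>y\<close> may contain further, larger
      ones.\<close>
    define \<sigma> where "\<sigma> = {V \<in> star x. w x V \<le> 1}"
    have \<sigma>\<tau>: "\<sigma> \<subseteq> \<tau>" using \<tau>(2) by (force simp: \<sigma>_def star_def w_def)
    have \<sigma>y: "\<sigma> \<subseteq> star y" using \<sigma>\<tau> \<open>\<tau> \<subseteq> \<V>\<close> \<tau>(1) by (auto simp: star_def)
    define \<eta> where "\<eta> = 4 / (8 * real (N \<tau>) * real (N \<tau>))"
    have "N \<tau> \<ge> 1" by (simp add: N_def)
    then have N1: "real (N \<tau>) \<ge> 1" by simp
    have z\<sigma>: "z \<in> reached d \<delta> \<sigma> R (w x)"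
    proof -
      obtain q where q: "walk d \<delta> (star x) R q" "w x (fst (hd q)) = 0" "cost (w x) q \<le> 1" "z = snd (last q)"
        using z unfolding f_def reached_def by blast
      \<comment> \<open>No single node can cost more than the whole walk.\<close>
      have "fst u \<in> \<sigma>" if u: "u \<in> set q" for u
      proof -
        have vq: "fst v \<in> star x" if "v \<in> set q" for v using q(1) that by (auto simp: walk_def)
        have "w x (fst u) \<le> cost (w x) q" using vq w_nonneg u by (intro weight_le_cost) auto
        then show ?thesis using vq[OF u] q(3) by (simp add: \<sigma>_def)
      qed
      then have "walk d \<delta> \<sigma> R q" using q(1) by (force simp: walk_def)
      then show ?thesis using q unfolding reached_def by blast
    qed
    obtain U where U: "U \<in> star y" "w y U = 0" using top[OF xyX(2)] by blast
    have "\<exists>z'\<in>reached d \<delta> (star y) R (w y). d z' z < \<delta>"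
    proof (rule reached_perturb[where d = d and \<sigma> = \<sigma> and R = R and w = "w x" and w' = "w y" and \<eta> = \<eta>
          and N = "N \<tau>" and U = U and \<tau> = "star y"])
      show "\<sigma> \<subseteq> star y" "finite (star y)" "U \<in> star y" "w y U = 0" "z \<in> reached d \<delta> \<sigma> R (w x)"
        by (fact \<sigma>y star_fin[OF xyX(2)] U z\<sigma>)+
      show "finite (R V)" "chained d \<delta> (R V)" "0 \<le> w y V" if "V \<in> star y" for V
        using that by (fact fin_at chained_at w_nonneg)+
      show "\<exists>a\<in>R V. \<exists>b\<in>R V'. d a b < \<delta>" if "V \<in> star y" "V' \<in> star y" for V V'
        using that by (fact touch)
      show "d a a < \<delta>" if "V \<in> star y" "a \<in> R V" for V a
        using M_at[OF that(1)] that(2) \<open>\<delta> > 0\<close> by auto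
      show "0 \<le> w x V" if "V \<in> \<sigma>" for V using that w_nonneg by (auto simp: \<sigma>_def)
      show "w y V \<le> w x V + \<eta>" if "V \<in> \<sigma>" for V
      proof -
        define c where "c = 2 / real (8 * N \<tau> * N \<tau>)"
        have "\<bar>l V x - l V y\<bar> < c" using \<tau>(3) that \<sigma>\<tau> unfolding c_def by blast
        then have "l V x - l V y < c" by (rule le_less_trans[OF abs_ge_self])
        moreover have "\<eta> = 2 * c" by (simp add: \<eta>_def c_def)
        ultimately show ?thesis unfolding w_def by (simp add: algebra_simps)
      qed
      show "0 \<le> \<eta>" by (simp add: \<eta>_def)
      show "2 * N \<tau> * N \<tau> * \<eta> \<le> 1" using N1 by (simp add: \<eta>_def)
      have "(\<Sum>V\<in>\<sigma>. card (R V)) \<le> (\<Sum>V\<in>\<tau>. card (R V))" using \<sigma>\<tau> \<open>finite \<tau>\<close> by (intro sum_mono2) auto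
      then show "(\<Sum>V\<in>\<sigma>. card (R V)) \<le> N \<tau>" by (simp add: N_def)
    qed
    then obtain z' where "z' \<in> f y" "d z' z < \<delta>" unfolding f_def by blast
    moreover have "f x \<subseteq> M" "f y \<subseteq> M" by (rule quasi_continuum_subset[OF fX], rule xyX)+
    ultimately show "z \<in> nhd \<delta> (f y)" using z by (auto simp: in_nhd)
  qed
  have "\<exists>W\<in>\<W>. \<exists>y\<in>W. x \<in> W \<and> z \<in> S y" if x: "x \<in> topspace X" and z: "z \<in> f x" for x z
  proof -
    have "z \<in> (\<Union>V\<in>star x. R V)" using z reached_subset unfolding f_def by (rule rev_subsetD)
    then obtain V where V: "V \<in> \<V>" "x \<in> V" "z \<in> R V" by (auto simp: star_def)
    then show ?thesis using p(1)[OF V(1)] R[OF V(1)] by blast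
  qed
  moreover have "\<exists>W\<in>\<W>. \<exists>y\<in>W. x \<in> W \<and> S y \<subseteq> nhd \<delta> (f x)" if x: "x \<in> topspace X" for x
  proof -
    obtain U where U: "U \<in> star x" "w x U = 0" using top[OF x] by blast
    have U': "U \<in> \<V>" "x \<in> U" using U by (auto simp: star_def)
    have U_sub: "R U \<subseteq> f x" unfolding f_def by (rule subset_reached[of U "star x" "w x", OF U])
    have "S (p U) \<subseteq> nhd \<delta> (f x)"
      by (rule subset_nhd_mono[OF _ U_sub, of _ "\<delta>/4"]) (use R[OF U'(1)] \<open>\<delta> > 0\<close> in auto)
    then show ?thesis using p(1)[OF U'(1)] U'(2) by blast
  qed
  moreover have "\<forall>W\<in>\<W>'. \<forall>x\<in>W. \<forall>y\<in>W. hclose \<delta> (f x) (f y)"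
    unfolding hclose_def using osc by blast
  ultimately show ?thesis
    using W'_cover fX by (intro exI[of _ \<W>'] exI[of _ f] conjI ballI) auto
qed

text \<open>Lower semicontinuity uses a ball around one point of the value; upper semicontinuity
  uses the positive gap between the compact value and a disjoint closed set.\<close>

lemma setvalued_continuousI:
  assumes comp: "\<And>x. x \<in> topspace X \<Longrightarrow> compactin mtopology (\<phi> x)"
    and close: "\<And>x e. x \<in> topspace X \<Longrightarrow> e > 0 \<Longrightarrow>
      \<exists>Q. openin X Q \<and> x \<in> Q \<and> (\<forall>y\<in>Q. hclose e (\<phi> x) (\<phi> y))"
  shows "setvalued_continuous X mtopology \<phi>"
  unfolding setvalued_continuous_def
proof
  show "lsc X mtopology \<phi>"
    unfolding lsc_def
  proof (intro allI impI)
    fix U assume U: "openin mtopology U"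
    show "openin X {x \<in> topspace X. \<phi> x \<inter> U \<noteq> {}}"
      unfolding openin_subopen[of X "{x \<in> topspace X. \<phi> x \<inter> U \<noteq> {}}"]
    proof
      fix x assume "x \<in> {x \<in> topspace X. \<phi> x \<inter> U \<noteq> {}}"
      then obtain u where x: "x \<in> topspace X" and u: "u \<in> \<phi> x" "u \<in> U" by blast
      then obtain e where e: "e > 0" "mball u e \<subseteq> U" using U unfolding openin_mtopology by blast
      obtain Q where Q: "openin X Q" "x \<in> Q" "\<forall>y\<in>Q. hclose e (\<phi> x) (\<phi> y)" using close[OF x e(1)] by blast
      have "\<phi> y \<inter> U \<noteq> {}" if y: "y \<in> Q" for y
      proof -
        have "\<phi> x \<subseteq> nhd e (\<phi> y)" using Q(3) y by (auto simp: hclose_def)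
        then obtain v where v: "v \<in> \<phi> y" "v \<in> M" "u \<in> M" "d v u < e" using subset_nhdD u(1) by meson
        then have "v \<in> mball u e" by (simp add: commute)
        then show ?thesis using e(2) v(1) by blast
      qed
      then show "\<exists>T. openin X T \<and> x \<in> T \<and> T \<subseteq> {x \<in> topspace X. \<phi> x \<inter> U \<noteq> {}}"
        using Q openin_subset by (intro exI[of _ Q]) blast
    qed
  qed
  show "usc X mtopology \<phi>"
    unfolding usc_def
  proof (intro allI impI)
    fix F assume F: "closedin mtopology F"
    have "openin X {x \<in> topspace X. \<phi> x \<inter> F = {}}"
      unfolding openin_subopen[of X "{x \<in> topspace X. \<phi> x \<inter> F = {}}"]
    proof
      fix x assume "x \<in> {x \<in> topspace X. \<phi> x \<inter> F = {}}"
      then have x: "x \<in> topspace X" "\<phi> x \<inter> F = {}" by auto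
      obtain e where e: "e > 0" "\<forall>a\<in>\<phi> x. \<forall>b\<in>F. e \<le> d a b"
        using compactin_closedin_gap[OF comp[OF x(1)] F x(2)] by blast
      obtain Q where Q: "openin X Q" "x \<in> Q" "\<forall>y\<in>Q. hclose e (\<phi> x) (\<phi> y)" using close[OF x(1) e(1)] by blast
      have "\<phi> y \<inter> F = {}" if y: "y \<in> Q" for y
      proof -
        have "\<phi> y \<subseteq> nhd e (\<phi> x)" using Q(3) y by (auto simp: hclose_def)
        then show ?thesis using subset_nhdD e(2) by (metis disjoint_iff not_le)
      qed
      then show "\<exists>T. openin X T \<and> x \<in> T \<and> T \<subseteq> {x \<in> topspace X. \<phi> x \<inter> F = {}}"
        using Q openin_subset by (intro exI[of _ Q]) blast
    qed
    moreover have "topspace X - {x \<in> topspace X. \<phi> x \<inter> F \<noteq> {}} = {x \<in> topspace X. \<phi> x \<inter> F = {}}" by blast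
    ultimately show "closedin X {x \<in> topspace X. \<phi> x \<inter> F \<noteq> {}}" by (auto simp: closedin_def)
  qed
qed

end

section \<open>The recursion over the stages and its limit\<close>

theorem theorem2p2:
  fixes X :: "'x topology" and M :: "'y set" and \<rho> :: "'y \<Rightarrow> 'y \<Rightarrow> real"
    and \<Phi> \<theta> :: "'x \<Rightarrow> 'y set"
  assumes "completely_regular_space X" and "Hausdorff_space X" and "infinite (topspace X)"
    and "Metric_space M \<rho>" and "Metric_space.mcomplete M \<rho>" and "infinite M"
    and "\<forall>x\<in>topspace X. \<Phi> x \<in> closed_connected_sets (Metric_space.mtopology M \<rho>)"
    and "uniformly_equi_LC0 M \<rho> (\<Phi> ` topspace X)"
    and "\<forall>x\<in>topspace X. \<theta> x \<in> compact_sets (Metric_space.mtopology M \<rho>)"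
    and "is_selection X \<theta> \<Phi>"
    and "slsf X (compact_connected_sets (Metric_space.mtopology M \<rho>)) (hausdorff_distance M \<rho>)
           (cc_between (Metric_space.mtopology M \<rho>) \<theta> \<Phi>)"
  shows "\<exists>\<phi>. (\<forall>x\<in>topspace X. \<phi> x \<in> compact_connected_sets (Metric_space.mtopology M \<rho>)) \<and>
             setvalued_continuous X (Metric_space.mtopology M \<rho>) \<phi> \<and>
             is_selection X \<theta> \<phi> \<and> is_selection X \<phi> \<Phi>"
proof -
  interpret Metric_space M \<rho> by fact
  have \<Phi>_closed: "closedin mtopology (\<Phi> x)" and \<Phi>_conn: "connectedin mtopology (\<Phi> x)"
    and \<theta>_comp: "compactin mtopology (\<theta> x)" and \<theta>_ne: "\<theta> x \<noteq> {}" and \<theta>\<Phi>: "\<theta> x \<subseteq> \<Phi> x"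
    if "x \<in> topspace X" for x
    using assms(7,9,10) that
    by (auto simp: closed_connected_sets_def closed_sets_def compact_sets_def is_selection_def)
  have "\<exists>\<delta>>0. \<forall>x\<in>topspace X. \<forall>K. quasi_continuum \<delta> (\<Phi> x) (\<theta> x) K \<longrightarrow>
      (\<exists>T\<in>cc_between mtopology \<theta> \<Phi> x. hclose \<kappa> T K)" if "\<kappa> > 0" for \<kappa>
  proof -
    have "\<exists>\<delta>>0. \<forall>S\<in>\<Phi> ` topspace X. \<forall>\<theta> K. compactin mtopology \<theta> \<and> \<theta> \<subseteq> S \<and> quasi_continuum \<delta> S \<theta> K \<longrightarrow>
           (\<exists>T\<in>compact_connected_sets mtopology. \<theta> \<subseteq> T \<and> T \<subseteq> S \<and> hclose \<kappa> T K)"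
      by (rule continuum_near_quasi_continuum[OF assms(5,8)]) (use \<Phi>_closed that in auto)
    then obtain \<delta> where "\<delta> > 0" and \<delta>: "\<forall>S\<in>\<Phi> ` topspace X. \<forall>\<theta> K. compactin mtopology \<theta> \<and> \<theta> \<subseteq> S \<and>
           quasi_continuum \<delta> S \<theta> K \<longrightarrow>
           (\<exists>T\<in>compact_connected_sets mtopology. \<theta> \<subseteq> T \<and> T \<subseteq> S \<and> hclose \<kappa> T K)" by blast
    have "\<exists>T\<in>cc_between mtopology \<theta> \<Phi> x. hclose \<kappa> T K"
      if "x \<in> topspace X" "quasi_continuum \<delta> (\<Phi> x) (\<theta> x) K" for x K
      using \<delta>[rule_format, of "\<Phi> x" "\<theta> x" K] \<theta>_comp \<theta>\<Phi> that by (auto simp: cc_between_def)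
    with \<open>\<delta> > 0\<close> show ?thesis by blast
  qed
  then obtain D where D_pos: "\<And>\<kappa>. \<kappa> > 0 \<Longrightarrow> D \<kappa> > 0"
    and D: "\<And>\<kappa> x K. \<kappa> > 0 \<Longrightarrow> x \<in> topspace X \<Longrightarrow> quasi_continuum (D \<kappa>) (\<Phi> x) (\<theta> x) K \<Longrightarrow>
      \<exists>T\<in>cc_between mtopology \<theta> \<Phi> x. hclose \<kappa> T K"
    by metis
  \<comment> \<open>A stage moves values by at most \<open>\<kappa> n + \<delta> n + \<delta> (Suc
    n) \<le> 3 * \<kappa> n\<close>, which the quarter keeps below \<open>1 / 2^n\<close>.\<close>
  define \<kappa> where "\<kappa> n = (1/4 :: real) / 2^n" for n :: nat
  have \<kappa>_pos: "\<kappa> n > 0" for n by (simp add: \<kappa>_def)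
  have \<kappa>_Suc: "\<kappa> (Suc n) \<le> \<kappa> n" and \<kappa>4: "4 * \<kappa> n = 1 / 2^n" for n by (simp_all add: \<kappa>_def field_simps)
  \<comment> \<open>The first bound provides exact continua within \<open>\<kappa> n\<close> of the
    values; the second bounds the oscillation and sends the scale to 0.\<close>
  define \<delta> where "\<delta> n = min (D (\<kappa> n)) (\<kappa> n)" for n
  have \<delta>_pos: "\<delta> n > 0" and \<delta>_le: "\<delta> n \<le> \<kappa> n" for n
    using D_pos[OF \<kappa>_pos] \<kappa>_pos by (simp_all add: \<delta>_def)
  have \<delta>_lim: "\<delta> \<longlonglongrightarrow> 0"
  proof (rule tendsto_sandwich[OF _ _ tendsto_const])
    show "\<kappa> \<longlonglongrightarrow> 0" unfolding \<kappa>_def by (rule LIMSEQ_divide_realpow_zero) simp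
    show "\<forall>\<^sub>F n in sequentially. 0 \<le> \<delta> n"
      using \<delta>_pos less_imp_le by (intro always_eventually allI) blast
    show "\<forall>\<^sub>F n in sequentially. \<delta> n \<le> \<kappa> n" using \<delta>_le by simp
  qed
  define stage where "stage n = (\<lambda>(\<W>, f). cozero_cover X \<W> \<and>
     (\<forall>x\<in>topspace X. quasi_continuum (\<delta> n) (\<Phi> x) (\<theta> x) (f x)) \<and>
     (\<forall>W\<in>\<W>. \<forall>x\<in>W. \<forall>y\<in>W. hclose (\<delta> n) (f x) (f y)))" for n
  define near where "near n = (\<lambda>(\<W> :: 'x set set, f) (\<W>' :: 'x set set, f').
     \<forall>x\<in>topspace X. hclose (1 / 2^n) (f x) (f' x))" for n :: nat
  have "\<exists>s. \<forall>n. stage n (s n) \<and> near n (s n) (s (Suc n))"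
  proof (rule dependent_nat_choice)
    \<comment> \<open>Any choice of continua starts the recursion, together with the one-element
      cover; no closeness to an earlier map is at stake, so the radius 1 is arbitrary.\<close>
    have "\<exists>T. T \<in> cc_between mtopology \<theta> \<Phi> x" if x: "x \<in> topspace X" for x
    proof -
      obtain K where "quasi_continuum (D 1) (\<Phi> x) (\<theta> x) K"
        using quasi_continuum_exists[OF \<Phi>_conn[OF x] \<theta>_comp[OF x] \<theta>\<Phi>[OF x] \<theta>_ne[OF x], of "D 1"] D_pos[of 1]
        by auto
      then show ?thesis using D[of 1 x K] x by auto
    qed
    then obtain S where S: "\<And>x. x \<in> topspace X \<Longrightarrow> S x \<in> cc_between mtopology \<theta> \<Phi> x" by metis
    have "cozero_in X (topspace X)"
      unfolding cozero_in_def by (intro exI[of _ "\<lambda>_. 1"]) auto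
    then have "cozero_cover X {topspace X}"
      by (simp add: cozero_cover_def finite_imp_locally_finite_in)
    from quasi_continuum_system[OF assms(11) this S \<theta>_ne \<delta>_pos[of 0]]
    show "\<exists>s. stage 0 s" unfolding stage_def by auto
  next
    fix s n assume "stage n s"
    then obtain \<W> f where s: "s = (\<W>, f)" and cover: "cozero_cover X \<W>"
      and qc: "\<And>x. x \<in> topspace X \<Longrightarrow> quasi_continuum (\<delta> n) (\<Phi> x) (\<theta> x) (f x)"
      and osc: "\<And>W x y. W \<in> \<W> \<Longrightarrow> x \<in> W \<Longrightarrow> y \<in> W \<Longrightarrow> hclose (\<delta> n) (f x) (f y)"
      unfolding stage_def by (cases s) auto
    have "\<exists>T\<in>cc_between mtopology \<theta> \<Phi> x. hclose (\<kappa> n) T (f x)" if x: "x \<in> topspace X" for x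
    proof -
      have "quasi_continuum (D (\<kappa> n)) (\<Phi> x) (\<theta> x) (f x)"
        using qc[OF x] by (rule quasi_continuum_mono) (simp add: \<delta>_def)
      then show ?thesis using D[OF \<kappa>_pos x] by blast
    qed
    then obtain S where S: "\<And>x. x \<in> topspace X \<Longrightarrow> S x \<in> cc_between mtopology \<theta> \<Phi> x"
      and S_near: "\<And>x. x \<in> topspace X \<Longrightarrow> hclose (\<kappa> n) (S x) (f x)" by metis
    from quasi_continuum_system[OF assms(11) cover S \<theta>_ne \<delta>_pos[of "Suc n"]]
    obtain \<W>' f' where stage': "stage (Suc n) (\<W>', f')"
      and f'1: "\<And>x z. x \<in> topspace X \<Longrightarrow> z \<in> f' x \<Longrightarrow> \<exists>W\<in>\<W>. \<exists>y\<in>W. x \<in> W \<and> z \<in> S y"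
      and f'2: "\<And>x. x \<in> topspace X \<Longrightarrow> \<exists>W\<in>\<W>. \<exists>y\<in>W. x \<in> W \<and> S y \<subseteq> nhd (\<delta> (Suc n)) (f' x)"
      unfolding stage_def by auto
    have WX: "y \<in> topspace X" if "W \<in> \<W>" "y \<in> W" for W y
      using cover that by (auto simp: cozero_cover_def)
    have "hclose (1 / 2^n) (f x) (f' x)" if x: "x \<in> topspace X" for x
      unfolding hclose_def
    proof
      obtain W y where y: "W \<in> \<W>" "y \<in> W" "x \<in> W" "S y \<subseteq> nhd (\<delta> (Suc n)) (f' x)"
        using f'2[OF x] by blast
      \<comment> \<open>\<open>S y\<close> is near \<open>f y\<close>, and \<open>f y\<close> is
        near \<open>f x\<close> because \<open>x\<close> and \<open>y\<close> share a member of the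
        old cover.\<close>
      have "hclose (\<kappa> n + \<delta> n) (S y) (f x)"
        using hclose_trans[OF S_near[OF WX[OF y(1,2)]] osc[OF y(1,2,3)]] .
      then have "f x \<subseteq> nhd (\<kappa> n + \<delta> n) (S y)" by (simp add: hclose_def)
      from metric_nhd_trans[OF this y(4)]
      show "f x \<subseteq> nhd (1 / 2^n) (f' x)"
        by (rule subset_nhd_mono) (use \<delta>_le[of n] \<delta>_le[of "Suc n"] \<kappa>_Suc[of n] \<kappa>4[of n] \<kappa>_pos[of n] in auto)
    next
      show "f' x \<subseteq> nhd (1 / 2^n) (f x)"
      proof
        fix z assume "z \<in> f' x"
        then obtain W y where y: "W \<in> \<W>" "y \<in> W" "x \<in> W" "z \<in> S y" using f'1[OF x] by blast
        have "hclose (\<kappa> n + \<delta> n) (S y) (f x)"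
          using hclose_trans[OF S_near[OF WX[OF y(1,2)]] osc[OF y(1,2,3)]] .
        then have "z \<in> nhd (\<kappa> n + \<delta> n) (f x)" using y(4) by (auto simp: hclose_def)
        moreover have "\<kappa> n + \<delta> n \<le> 1 / 2^n" using \<delta>_le[of n] \<kappa>4[of n] \<kappa>_pos[of n] by linarith
        ultimately show "z \<in> nhd (1 / 2^n) (f x)" using metric_nhd_mono by blast
      qed
    qed
    then have "near n s (\<W>', f')" by (simp add: near_def s)
    with stage' show "\<exists>s'. stage (Suc n) s' \<and> near n s s'" by blast
  qed
  then obtain s where s: "\<And>n. stage n (s n)" "\<And>n. near n (s n) (s (Suc n))" by blast
  define \<W> where "\<W> n = fst (s n)" for n
  define f where "f n = snd (s n)" for n
  have cover: "cozero_cover X (\<W> n)"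
    and qc: "x \<in> topspace X \<Longrightarrow> quasi_continuum (\<delta> n) (\<Phi> x) (\<theta> x) (f n x)"
    and osc: "W \<in> \<W> n \<Longrightarrow> x \<in> W \<Longrightarrow> y \<in> W \<Longrightarrow> hclose (\<delta> n) (f n x) (f n y)" for n x y W
    using s(1)[of n] by (auto simp: stage_def \<W>_def f_def case_prod_beta)
  have f_near: "hclose (1 / 2^n) (f n x) (f (Suc n) x)" if "x \<in> topspace X" for n x
    using s(2)[of n] that by (auto simp: near_def f_def case_prod_beta)
  have "\<exists>T\<in>compact_connected_sets mtopology. \<theta> x \<subseteq> T \<and> T \<subseteq> \<Phi> x \<and> (\<forall>n. hclose (4 * 1 / 2^n) T (f n x))"
    if x: "x \<in> topspace X" for x
    by (rule quasi_continua_limit[OF assms(5) \<Phi>_closed[OF x] qc[OF x] \<delta>_lim f_near[OF x]]) simp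
  then obtain \<phi> where \<phi>: "\<And>x. x \<in> topspace X \<Longrightarrow> \<phi> x \<in> compact_connected_sets mtopology"
      "\<And>x. x \<in> topspace X \<Longrightarrow> \<theta> x \<subseteq> \<phi> x \<and> \<phi> x \<subseteq> \<Phi> x"
      "\<And>x n. x \<in> topspace X \<Longrightarrow> hclose (4 * 1 / 2^n) (\<phi> x) (f n x)"
    by metis
  have "setvalued_continuous X mtopology \<phi>"
  proof (rule setvalued_continuousI)
    show "compactin mtopology (\<phi> x)" if "x \<in> topspace X" for x
      using \<phi>(1)[OF that] by (simp add: compact_connected_sets_def compact_sets_def)
    fix x and e :: real assume x: "x \<in> topspace X" and "e > 0"
    \<comment> \<open>Passing from \<open>\<phi>\<close> to \<open>f n\<close> at both points costs
      \<open>4 / 2^n\<close> each, and the oscillation of \<open>f n\<close> on a member adds at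
      most \<open>1 / 2^n\<close>.\<close>
    have "(\<lambda>n. 9 / 2^n :: real) \<longlonglongrightarrow> 0" by (rule LIMSEQ_divide_realpow_zero) simp
    from order_tendstoD(2)[OF this \<open>e > 0\<close>] obtain n where n: "9 / 2^n < e"
      by (auto simp: eventually_sequentially)
    obtain W where W: "W \<in> \<W> n" "x \<in> W" using cover[of n] x by (auto simp: cozero_cover_def)
    obtain g where g: "continuous_map X euclideanreal g" "W = {x \<in> topspace X. g x \<noteq> 0}"
      using cover[of n] W(1) unfolding cozero_cover_def cozero_in_def by blast
    have "openin X W"
      using openin_continuous_map_preimage[OF g(1), of "- {0}"] g(2) by auto
    moreover have "hclose e (\<phi> x) (\<phi> y)" if y: "y \<in> W" for y
    proof -
      have yX: "y \<in> topspace X" using y g(2) by blast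
      have "hclose (4 * 1 / 2^n + \<delta> n + 4 * 1 / 2^n) (\<phi> x) (\<phi> y)"
        using hclose_trans[OF hclose_trans[OF \<phi>(3)[OF x] osc[OF W y]] hclose_sym[OF \<phi>(3)[OF yX]]] .
      moreover have "\<delta> n \<le> 1 / 2^n" using \<delta>_le[of n] \<kappa>4[of n] \<kappa>_pos[of n] by linarith
      then have "4 * 1 / 2^n + \<delta> n + 4 * 1 / 2^n \<le> 9 / 2^n" by simp
      ultimately show ?thesis using hclose_mono n by (meson less_imp_le order_trans)
    qed
    ultimately show "\<exists>Q. openin X Q \<and> x \<in> Q \<and> (\<forall>y\<in>Q. hclose e (\<phi> x) (\<phi> y))" using W(2) by blast
  qed
  with \<phi>(1,2) show ?thesis unfolding is_selection_def by blast
qed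

end
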